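(* Let $\Lambda$ be a countable discrete group satisfying the strong Atiyah conjecture, and let $\Gamma$ be a countable group containing $\Lambda$ as a normal subgroup of finite index $[\Gamma:\Lambda]$. If $[\Gamma:\Lambda]^2\cdot\sigma(\Lambda)<\theta(\Lambda)$, then $\mathbb{C}\Gamma$ is not $C^*_r$-unique.
   Context: For a countable group $G$: $LG=\lambda(\mathbb{C}G)''\subset\mathbb{B}(\ell^2G)$ is the group von Neumann algebra with trace $\tau(x)=\langle x\delta_e,\delta_e\rangle$. The central granularity is $\sigma(G)=\inf\{\tau(p)\mid p\text{ a nonzero projection in } Z(LG)\}\in[0,1]$. The torsion multiplier is $\theta(G)=1/\mathrm{lcm}\{|H|: H\le G \text{ finite}\}\in[0,1]$, with the conventions that the lcm of an infinite set of natural numbers is $\infty$ and $1/\infty=0$. Let $\frac{1}{|\mathrm{FIN}(G)|}\mathbb{Z}$ be the additive subgroup of $\mathbb{Q}$ generated by $\{1/|H| : H\le G\text{ finite}\}$. For $A\in\mathbb{M}_n(\mathbb{C}G)$ let $L_A\in LG\otimes\mathbb{M}_n(\mathbb{C})\subset\mathbb{B}(\ell^2(G)^n)$ be left multiplication by $A$ via the left regular representation, and $\dim_{LG}\ker L_A=(\tau\otimes\mathrm{Tr})(P_{\ker L_A})$, where $\mathrm{Tr}$ is the unnormalized trace on $\mathbb{M}_n(\mathbb{C})$ and $P_{\ker L_A}$ is the kernel projection. $G$ satisfies the strong Atiyah conjecture if $\dim_{LG}\ker L_A\in\frac{1}{|\mathrm{FIN}(G)|}\mathbb{Z}$ for all $n\ge1$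 and all $A\in\mathbb{M}_n(\mathbb{C}G)$. $\mathbb{C}\Gamma$ is $C^*_r$-unique if no $C^*$-norm on $\mathbb{C}\Gamma$ is properly majorised by the reduced $C^*$-norm (the norm from the left regular representation). *)

theory Defs
  imports "HOL-Analysis.Analysis" "HOL-Library.Countable"
begin

text \<open>Groups are written additively via the type class group_add (which does NOT
assume commutativity). A subgroup is a subset H of the type. Functions
'g => complex supported in H model elements of l2(H) and of CH.\<close>

definition subgrp :: "'g::group_add set \<Rightarrow> bool" where
  "subgrp H \<longleftrightarrow> 0 \<in> H \<and> (\<forall>x\<in>H. \<forall>y\<in>H. x + y \<in> H) \<and> (\<forall>x\<in>H. - x \<in> H)"

definition normal_subgrp :: "'g::group_add set \<Rightarrow> bool" where
  "normal_subgrp H \<longleftrightarrow> subgrp H \<and> (\<forall>x. \<forall>h\<in>H. x + h - x \<in> H)"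

definition cosets :: "'g::group_add set \<Rightarrow> 'g set set" where
  "cosets H = {((+) x) ` H | x. True}"

definition grp_index :: "'g::group_add set \<Rightarrow> nat" where
  "grp_index H = card (cosets H)"

definition l2 :: "'g set \<Rightarrow> ('g \<Rightarrow> complex) set" where
  "l2 H = {f. (\<forall>x. x \<notin> H \<longrightarrow> f x = 0) \<and> (\<lambda>x. (cmod (f x))\<^sup>2) summable_on H}"

definition l2_inner :: "'g set \<Rightarrow> ('g \<Rightarrow> complex) \<Rightarrow> ('g \<Rightarrow> complex) \<Rightarrow> complex" where
  "l2_inner H f g = infsum (\<lambda>x. f x * cnj (g x)) H"

definition l2_norm :: "'g set \<Rightarrow> ('g \<Rightarrow> complex) \<Rightarrow> real" where
  "l2_norm H f = sqrt (infsum (\<lambda>x. (cmod (f x))\<^sup>2) H)"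

definition grp_alg :: "'g set \<Rightarrow> ('g \<Rightarrow> complex) set" where
  "grp_alg H = {a. finite {x. a x \<noteq> 0} \<and> {x. a x \<noteq> 0} \<subseteq> H}"

definition lreg :: "'g::group_add set \<Rightarrow> ('g \<Rightarrow> complex) \<Rightarrow> ('g \<Rightarrow> complex) \<Rightarrow> ('g \<Rightarrow> complex)" where
  "lreg H a f = (\<lambda>x. if x \<in> H then (\<Sum>g\<in>{y. a y \<noteq> 0}. a g * f (- g + x)) else 0)"

definition delta_e :: "'g::group_add \<Rightarrow> complex" where
  "delta_e = (\<lambda>x. if x = 0 then 1 else 0)"

text \<open>Operators are functions on 'g => complex; only their values on l2 H matter.\<close>
definition bdd_op :: "'g set \<Rightarrow> (('g \<Rightarrow> complex) \<Rightarrow> ('g \<Rightarrow> complex)) \<Rightarrow> bool" where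
  "bdd_op H T \<longleftrightarrow>
     (\<forall>f\<in>l2 H. T f \<in> l2 H) \<and>
     (\<forall>f\<in>l2 H. \<forall>g\<in>l2 H. T (\<lambda>x. f x + g x) = (\<lambda>x. T f x + T g x)) \<and>
     (\<forall>f\<in>l2 H. \<forall>c. T (\<lambda>x. c * f x) = (\<lambda>x. c * T f x)) \<and>
     (\<exists>C. \<forall>f\<in>l2 H. l2_norm H (T f) \<le> C * l2_norm H f)"

definition commutant :: "'g set \<Rightarrow> (('g \<Rightarrow> complex) \<Rightarrow> ('g \<Rightarrow> complex)) set
    \<Rightarrow> (('g \<Rightarrow> complex) \<Rightarrow> ('g \<Rightarrow> complex)) set" where
  "commutant H M = {T. bdd_op H T \<and> (\<forall>S\<in>M. \<forall>f\<in>l2 H. T (S f) = S (T f))}"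

definition group_vN :: "'g::group_add set \<Rightarrow> (('g \<Rightarrow> complex) \<Rightarrow> ('g \<Rightarrow> complex)) set" where
  "group_vN H = commutant H (commutant H (lreg H ` grp_alg H))"

definition vN_center :: "'g::group_add set \<Rightarrow> (('g \<Rightarrow> complex) \<Rightarrow> ('g \<Rightarrow> complex)) set" where
  "vN_center H = group_vN H \<inter> commutant H (group_vN H)"

definition is_projection :: "'g set \<Rightarrow> (('g \<Rightarrow> complex) \<Rightarrow> ('g \<Rightarrow> complex)) \<Rightarrow> bool" where
  "is_projection H P \<longleftrightarrow> bdd_op H P \<and> (\<forall>f\<in>l2 H. P (P f) = P f) \<and>
     (\<forall>f\<in>l2 H. \<forall>g\<in>l2 H. l2_inner H (P f) g = l2_inner H f (P g))"

definition nonzero_op :: "'g set \<Rightarrow> (('g \<Rightarrow> complex) \<Rightarrow> ('g \<Rightarrow> complex)) \<Rightarrow> bool" where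
  "nonzero_op H T \<longleftrightarrow> (\<exists>f\<in>l2 H. T f \<noteq> (\<lambda>x. 0))"

definition vN_trace :: "'g::group_add set \<Rightarrow> (('g \<Rightarrow> complex) \<Rightarrow> ('g \<Rightarrow> complex)) \<Rightarrow> complex" where
  "vN_trace H T = l2_inner H (T delta_e) delta_e"

text \<open>Central granularity sigma(H) (tau(p) is real and >= 0 for projections p).\<close>
definition central_granularity :: "'g::group_add set \<Rightarrow> real" where
  "central_granularity H =
     Inf {Re (vN_trace H p) | p. p \<in> vN_center H \<and> is_projection H p \<and> nonzero_op H p}"

definition fin_orders :: "'g::group_add set \<Rightarrow> nat set" where
  "fin_orders H = {card K | K. subgrp K \<and> K \<subseteq> H \<and> finite K}"

definition torsion_multiplier :: "'g::group_add set \<Rightarrow> real" where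
  "torsion_multiplier H =
     (if finite (fin_orders H) then 1 / real (Lcm (fin_orders H)) else 0)"

definition l2n :: "'g set \<Rightarrow> nat \<Rightarrow> (nat \<Rightarrow> 'g \<Rightarrow> complex) set" where
  "l2n H n = {v. (\<forall>i<n. v i \<in> l2 H) \<and> (\<forall>i\<ge>n. v i = (\<lambda>x. 0))}"

definition l2n_inner :: "'g set \<Rightarrow> nat \<Rightarrow> (nat \<Rightarrow> 'g \<Rightarrow> complex) \<Rightarrow> (nat \<Rightarrow> 'g \<Rightarrow> complex) \<Rightarrow> complex" where
  "l2n_inner H n v w = (\<Sum>i<n. l2_inner H (v i) (w i))"

definition mat_op :: "'g::group_add set \<Rightarrow> nat \<Rightarrow> (nat \<Rightarrow> nat \<Rightarrow> 'g \<Rightarrow> complex)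
    \<Rightarrow> (nat \<Rightarrow> 'g \<Rightarrow> complex) \<Rightarrow> (nat \<Rightarrow> 'g \<Rightarrow> complex)" where
  "mat_op H n A v = (\<lambda>i. if i < n then (\<lambda>x. \<Sum>j<n. lreg H (A i j) (v j) x) else (\<lambda>x. 0))"

definition mat_kernel :: "'g::group_add set \<Rightarrow> nat \<Rightarrow> (nat \<Rightarrow> nat \<Rightarrow> 'g \<Rightarrow> complex)
    \<Rightarrow> (nat \<Rightarrow> 'g \<Rightarrow> complex) set" where
  "mat_kernel H n A = {v \<in> l2n H n. mat_op H n A v = (\<lambda>i x. 0)}"

definition orth_proj :: "'g set \<Rightarrow> nat \<Rightarrow> (nat \<Rightarrow> 'g \<Rightarrow> complex) set
    \<Rightarrow> (nat \<Rightarrow> 'g \<Rightarrow> complex) \<Rightarrow> (nat \<Rightarrow> 'g \<Rightarrow> complex)" where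
  "orth_proj H n K w = (THE u. u \<in> K \<and>
      (\<forall>k\<in>K. l2n_inner H n (\<lambda>i x. w i x - u i x) k = 0))"

definition unit_vec :: "nat \<Rightarrow> nat \<Rightarrow> nat \<Rightarrow> 'g::group_add \<Rightarrow> complex" where
  "unit_vec n i = (\<lambda>j. if j = i \<and> i < n then delta_e else (\<lambda>x. 0))"

text \<open>dim_{LH} ker L_A = (tau (x) Tr)(P_ker) = sum_i <P(delta_e e_i), delta_e e_i>.\<close>
definition vN_dim_ker :: "'g::group_add set \<Rightarrow> nat \<Rightarrow> (nat \<Rightarrow> nat \<Rightarrow> 'g \<Rightarrow> complex) \<Rightarrow> real" where
  "vN_dim_ker H n A = Re (\<Sum>i<n. l2n_inner H n
      (orth_proj H n (mat_kernel H n A) (unit_vec n i)) (unit_vec n i))"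

definition in_fin_lattice :: "'g::group_add set \<Rightarrow> real \<Rightarrow> bool" where
  "in_fin_lattice H r \<longleftrightarrow> (\<exists>S c. finite S \<and> (\<forall>K\<in>S. subgrp K \<and> K \<subseteq> H \<and> finite K) \<and>
      r = (\<Sum>K\<in>S. real_of_int (c K) / real (card K)))"

definition strong_atiyah :: "'g::group_add set \<Rightarrow> bool" where
  "strong_atiyah H \<longleftrightarrow> (\<forall>n\<ge>1. \<forall>A. (\<forall>i<n. \<forall>j<n. A i j \<in> grp_alg H) \<longrightarrow>
      in_fin_lattice H (vN_dim_ker H n A))"

definition conv :: "('g::group_add \<Rightarrow> complex) \<Rightarrow> ('g \<Rightarrow> complex) \<Rightarrow> ('g \<Rightarrow> complex)" where
  "conv a b = (\<lambda>x. \<Sum>g\<in>{y. a y \<noteq> 0}. a g * b (- g + x))"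

definition inv_star :: "('g::group_add \<Rightarrow> complex) \<Rightarrow> ('g \<Rightarrow> complex)" where
  "inv_star a = (\<lambda>x. cnj (a (- x)))"

definition cstar_norm :: "(('g::group_add \<Rightarrow> complex) \<Rightarrow> real) \<Rightarrow> bool" where
  "cstar_norm \<nu> \<longleftrightarrow>
     (\<forall>a\<in>grp_alg UNIV. \<nu> a \<ge> 0 \<and> (\<nu> a = 0 \<longleftrightarrow> a = (\<lambda>x. 0))) \<and>
     (\<forall>a\<in>grp_alg UNIV. \<forall>b\<in>grp_alg UNIV. \<nu> (\<lambda>x. a x + b x) \<le> \<nu> a + \<nu> b) \<and>
     (\<forall>a\<in>grp_alg UNIV. \<forall>c. \<nu> (\<lambda>x. c * a x) = cmod c * \<nu> a) \<and>
     (\<forall>a\<in>grp_alg UNIV. \<forall>b\<in>grp_alg UNIV. \<nu> (conv a b) \<le> \<nu> a * \<nu> b) \<and>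
     (\<forall>a\<in>grp_alg UNIV. \<nu> (conv (inv_star a) a) = (\<nu> a)\<^sup>2)"

definition reduced_norm :: "('g::group_add \<Rightarrow> complex) \<Rightarrow> real" where
  "reduced_norm a = Sup {l2_norm UNIV (lreg UNIV a f) | f. f \<in> l2 UNIV \<and> l2_norm UNIV f \<le> 1}"

definition cr_unique :: "'g::group_add itself \<Rightarrow> bool" where
  "cr_unique _ \<longleftrightarrow> \<not> (\<exists>\<nu>::('g \<Rightarrow> complex) \<Rightarrow> real. cstar_norm \<nu> \<and>
      (\<forall>a\<in>grp_alg UNIV. \<nu> a \<le> reduced_norm a) \<and>
      (\<exists>a\<in>grp_alg UNIV. \<nu> a \<noteq> reduced_norm a))"

end

theory Submission
  imports Defs
begin

text \<open>
  Write \<open>N = [\<Gamma>:\<Lambda>]\<close>. A central projection \<open>p\<close> of \<open>L\<Lambda>\<close> with \<open>N\<^sup>2 \<tau>(p) < \<theta>(\<Lambda>)\<close> gives a class function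
  \<open>\<phi> = p \<delta>\<^sub>e\<close> in \<open>\<ell>\<^sup>2(\<Lambda>)\<close>. Being square-summable, it can be truncated to a finitely supported
  self-adjoint class function \<open>z\<close> near \<open>\<phi>\<close>. The sum \<open>T\<close> of the conjugates of \<open>\<lambda>(z)\<^sup>2\<close> over
  \<open>\<Gamma>/\<Lambda>\<close> is a positive central element of \<open>\<complex>\<Gamma>\<close>.

  Fix \<open>r < 1\<close> close to \<open>1\<close> and let \<open>V\<close> be the spectral subspace of \<open>T\<close> for \<open>(-\<infinity>, r]\<close>, which is invariant
  under \<open>\<complex>\<Gamma>\<close>. The norm of the restriction to \<open>V\<close> is a \<open>C\<^sup>*\<close>-seminorm below the reduced norm, and it
  differs from it at \<open>T\<close>: it is at most \<open>r\<close> there, whereas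
  \<open>\<langle>T \<phi>, \<phi>\<rangle> \<ge> \<parallel>\<lambda>(z) \<phi>\<parallel>\<^sup>2 > r \<parallel>\<phi>\<parallel>\<^sup>2\<close>. It is a norm: by Markov's inequality the \<open>L\<Lambda>\<close>-dimension of
  the complement of \<open>V\<close> is at most \<open>N\<^sup>2 \<tau>(p) / r < \<theta>(\<Lambda>)\<close>, so for an element of \<open>\<complex>\<Gamma>\<close> vanishing on
  \<open>V\<close> the strong Atiyah conjecture leaves \<open>N\<close> as the only possible dimension of the kernel.
\<close>

section \<open>Spectral subspaces of self-adjoint operators\<close>

text \<open>A minimising sequence for the distance to \<open>V\<close> is Cauchy by the
  parallelogram law, and its limit is the nearest point. The inner product here is real; complex
  orthogonality is recovered later for subspaces closed under \<open>cscale\<close>.\<close>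

lemma closed_subspace_projection:
  fixes V :: "'a::{real_inner,banach} set"
  assumes V: "subspace V" and cl: "closed V"
  shows "\<exists>u\<in>V. \<forall>k\<in>V. inner (w - u) k = 0"
proof -
  define d where "d = infdist w V"
  have ne: "V \<noteq> {}" using subspace_0[OF V] by auto
  have d0: "d \<ge> 0" unfolding d_def by (rule infdist_nonneg)
  have dle: "d\<^sup>2 \<le> (norm (w - u))\<^sup>2" if "u \<in> V" for u
    using infdist_le[OF that, of w] d0 unfolding d_def dist_norm by (rule power_mono)
  have "\<exists>u\<in>V. (norm (w - u))\<^sup>2 < d\<^sup>2 + 1 / real (Suc n)" for n
  proof -
    have "d < sqrt (d\<^sup>2 + 1 / real (Suc n))"
      using d0 by (intro real_less_rsqrt) auto
    moreover have "d = (INF u\<in>V. dist w u)" unfolding d_def by (rule infdist_notempty[OF ne])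
    ultimately obtain u where u: "u \<in> V" "dist w u < sqrt (d\<^sup>2 + 1 / real (Suc n))"
      using cINF_less_iff[OF ne bdd_belowI2[of V 0 "dist w"], of "sqrt (d\<^sup>2 + 1 / real (Suc n))"]
      by (simp only: zero_le_dist simp_thms) blast
    have "(dist w u)\<^sup>2 < (sqrt (d\<^sup>2 + 1 / real (Suc n)))\<^sup>2"
      using u(2) by (intro power_strict_mono) auto
    then show ?thesis using u(1) by (auto simp: dist_norm add_nonneg_nonneg intro!: bexI[of _ u])
  qed
  then obtain u where u: "\<And>n. u n \<in> V" "\<And>n. (norm (w - u n))\<^sup>2 < d\<^sup>2 + 1 / real (Suc n)"
    by metis
  have par: "(norm (u m - u n))\<^sup>2 \<le> 2 * (1 / real (Suc m)) + 2 * (1 / real (Suc n))" for m n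
  proof -
    have mid: "(1/2) *\<^sub>R (u m + u n) \<in> V"
      by (intro subspace_scale[OF V] subspace_add[OF V] u)
    \<comment> \<open>Parallelogram law for \<open>w - u m\<close> and \<open>w - u n\<close>. The
      midpoint lies in \<open>V\<close>, so its distance to \<open>w\<close> is at least
      \<open>d\<close>.\<close>
    have "(norm (u m - u n))\<^sup>2 = 2 * (norm (w - u m))\<^sup>2 + 2 * (norm (w - u n))\<^sup>2
        - 4 * (norm (w - (1/2) *\<^sub>R (u m + u n)))\<^sup>2"
      by (simp add: power2_norm_eq_inner inner_diff_left inner_diff_right inner_add_left
          inner_add_right inner_commute algebra_simps)
    then show ?thesis using dle[OF mid] u(2)[of m] u(2)[of n] by linarith
  qed
  have "Cauchy u"
  proof (rule CauchyI)
    fix e :: real assume e: "e > 0"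
    obtain N where "4 / e\<^sup>2 < real N" using reals_Archimedean2 by blast
    then have N: "4 / e\<^sup>2 < real (Suc N)" by simp
    show "\<exists>M. \<forall>m\<ge>M. \<forall>n\<ge>M. norm (u m - u n) < e"
    proof (intro exI allI impI)
      fix m n assume mn: "m \<ge> N" "n \<ge> N"
      have "2 / real (Suc m) + 2 / real (Suc n) \<le> 2 / real (Suc N) + 2 / real (Suc N)"
        using mn by (intro add_mono divide_left_mono) auto
      also have "\<dots> = 4 / real (Suc N)" by simp
      also have "\<dots> < e\<^sup>2" using N e by (simp add: field_simps)
      finally have "(norm (u m - u n))\<^sup>2 < e\<^sup>2" using par[of m n] by simp
      then show "norm (u m - u n) < e" by (rule power2_less_imp_less) (use e in simp)
    qed
  qed
  then obtain v where v: "u \<longlonglongrightarrow> v" using Cauchy_convergent_iff convergent_def by blast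
  have vV: "v \<in> V" using closed_sequentially[OF cl u(1) v] .
  have lim: "(\<lambda>n. (norm (w - u n))\<^sup>2) \<longlonglongrightarrow> (norm (w - v))\<^sup>2"
    by (intro tendsto_intros v)
  have "(\<lambda>n. d\<^sup>2 + 1 / real (Suc n)) \<longlonglongrightarrow> d\<^sup>2 + 0"
    by (intro tendsto_add tendsto_const LIMSEQ_Suc lim_1_over_n)
  then have "(norm (w - v))\<^sup>2 \<le> d\<^sup>2 + 0"
    using u(2) by (intro LIMSEQ_le[OF lim]) (auto intro: less_imp_le)
  then have dv: "(norm (w - v))\<^sup>2 = d\<^sup>2" using dle[OF vV] by simp
  have "inner (w - v) k = 0" if k: "k \<in> V" for k
  proof (cases "k = 0")
    case False
    \<comment> \<open>This \<open>t\<close> minimises the quadratic polynomial giving the squared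
      distance from \<open>w\<close> to \<open>v + t k\<close>; a nonzero value would contradict the
      minimality of \<open>v\<close>.\<close>
    define t where "t = inner (w - v) k / (norm k)\<^sup>2"
    have "v + t *\<^sub>R k \<in> V" by (intro subspace_add[OF V] subspace_scale[OF V] vV k)
    note le = dle[OF this]
    have expand: "(norm (z - t *\<^sub>R k))\<^sup>2 = (norm z)\<^sup>2 - 2 * t * inner z k + t\<^sup>2 * (norm k)\<^sup>2" for z
      unfolding power2_norm_eq_inner using inner_commute[of k z]
      by (simp add: inner_diff_left inner_diff_right power2_eq_square algebra_simps)
    from le have "(norm (w - v))\<^sup>2 \<le> (norm ((w - v) - t *\<^sub>R k))\<^sup>2"
      using dv by (simp add: algebra_simps)
    also have "\<dots> = (norm (w - v))\<^sup>2 - 2 * t * inner (w - v) k + t\<^sup>2 * (norm k)\<^sup>2"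
      by (rule expand)
    also have "\<dots> = (norm (w - v))\<^sup>2 - (inner (w - v) k)\<^sup>2 / (norm k)\<^sup>2"
      using False by (simp add: t_def field_simps power2_eq_square)
    finally have "(inner (w - v) k)\<^sup>2 / (norm k)\<^sup>2 \<le> 0" by simp
    then show ?thesis using False by (simp add: divide_le_0_iff)
  qed auto
  then show ?thesis using vV by blast
qed

section \<open>Square roots of positive operators by iteration\<close>

primrec sqrt_iter :: "('a::real_normed_vector \<Rightarrow>\<^sub>L 'a) \<Rightarrow> nat \<Rightarrow> ('a \<Rightarrow>\<^sub>L 'a)" where
  "sqrt_iter A 0 = 0"
| "sqrt_iter A (Suc n) = (1/2) *\<^sub>R (A + (sqrt_iter A n o\<^sub>L sqrt_iter A n))"

text \<open>The same iteration for the scalar \<open>1\<close>; its increments majorise those of \<open>sqrt_iter A\<close>.\<close>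
primrec sqrt_iter_bound :: "nat \<Rightarrow> real" where
  "sqrt_iter_bound 0 = 0"
| "sqrt_iter_bound (Suc n) = (1 + (sqrt_iter_bound n)\<^sup>2) / 2"

lemma sqrt_iter_bound_range: "0 \<le> sqrt_iter_bound n \<and> sqrt_iter_bound n \<le> 1"
  by (induction n) (auto simp: power_le_one)

lemma norm_sqrt_iter:
  assumes "norm A \<le> 1"
  shows "norm (sqrt_iter A n) \<le> sqrt_iter_bound n"
proof (induction n)
  case (Suc n)
  have "norm (sqrt_iter A n o\<^sub>L sqrt_iter A n) \<le> norm (sqrt_iter A n) * norm (sqrt_iter A n)"
    by (rule norm_blinfun_compose)
  also have "\<dots> \<le> (sqrt_iter_bound n)\<^sup>2"
    unfolding power2_eq_square using Suc by (intro mult_mono) (auto simp: sqrt_iter_bound_range)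
  finally have "norm (A + (sqrt_iter A n o\<^sub>L sqrt_iter A n)) \<le> 1 + (sqrt_iter_bound n)\<^sup>2"
    using assms norm_triangle_ineq[of A "sqrt_iter A n o\<^sub>L sqrt_iter A n"] by linarith
  then show ?case by simp
qed simp

text \<open>A difference of squares is written as \<open>Y' (Y' - Y) + (Y' - Y) Y\<close>, which
  needs no commutativity. Each factor is dominated by its scalar counterpart, and the scalar
  iteration satisfies the same identity exactly.\<close>

lemma norm_sqrt_iter_step:
  assumes "norm A \<le> 1"
  shows "norm (sqrt_iter A (Suc n) - sqrt_iter A n) \<le> sqrt_iter_bound (Suc n) - sqrt_iter_bound n"
proof (induction n)
  case 0
  then show ?case using assms by simp
next
  case (Suc n)
  let ?Y = "sqrt_iter A" and ?y = sqrt_iter_bound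
  have "?Y (Suc (Suc n)) - ?Y (Suc n)
      = (1/2) *\<^sub>R ((?Y (Suc n) o\<^sub>L (?Y (Suc n) - ?Y n)) + ((?Y (Suc n) - ?Y n) o\<^sub>L ?Y n))"
    unfolding sqrt_iter.simps(2)[of A "Suc n"] sqrt_iter.simps(2)[of A "n"]
    by (rule blinfun_eqI) (simp add: blinfun.bilinear_simps algebra_simps)
  also have "norm \<dots> \<le> (1/2) * (norm (?Y (Suc n)) * norm (?Y (Suc n) - ?Y n)
      + norm (?Y (Suc n) - ?Y n) * norm (?Y n))"
    by (auto intro!: norm_triangle_le add_mono norm_blinfun_compose simp del: sqrt_iter.simps)
  also have "\<dots> \<le> (1/2) * (?y (Suc n) * (?y (Suc n) - ?y n) + (?y (Suc n) - ?y n) * ?y n)"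
    using Suc norm_sqrt_iter[OF assms] sqrt_iter_bound_range
    by (intro mult_left_mono add_mono mult_mono order_trans[OF norm_ge_zero Suc])
      (auto simp del: sqrt_iter.simps sqrt_iter_bound.simps)
  also have "\<dots> = ?y (Suc (Suc n)) - ?y (Suc n)"
    unfolding sqrt_iter_bound.simps(2)[of "Suc n"] sqrt_iter_bound.simps(2)[of "n"]
    by (simp add: power2_eq_square field_simps)
  finally show ?case .
qed

lemma norm_sqrt_iter_diff:
  assumes "norm A \<le> 1" "n \<le> m"
  shows "norm (sqrt_iter A m - sqrt_iter A n) \<le> sqrt_iter_bound m - sqrt_iter_bound n"
  using assms(2)
proof (induction m rule: dec_induct)
  case (step m)
  have "sqrt_iter A (Suc m) - sqrt_iter A n
      = (sqrt_iter A (Suc m) - sqrt_iter A m) + (sqrt_iter A m - sqrt_iter A n)" by simp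
  then show ?case
    using norm_triangle_mono[OF norm_sqrt_iter_step[OF assms(1), of m] step(3)] by simp
qed simp

text \<open>The scalar iterates increase and stay below 1, so they converge, and the increments of
  the operator iterates are dominated by theirs. The comparison covers the boundary case
  \<open>norm A = 1\<close>, where a geometric estimate would fail.\<close>

lemma Cauchy_sqrt_iter:
  assumes "norm A \<le> 1"
  shows "Cauchy (sqrt_iter A)"
proof (rule CauchyI)
  fix e :: real assume e: "e > 0"
  have inc: "incseq sqrt_iter_bound"
    using order_trans[OF norm_ge_zero norm_sqrt_iter_step[OF assms]]
    by (intro incseq_SucI) (metis diff_ge_0_iff_ge)
  have "convergent sqrt_iter_bound"
    using incseq_convergent[OF inc] sqrt_iter_bound_range unfolding convergent_def by metis
  then have "Cauchy sqrt_iter_bound" by (rule convergent_Cauchy)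
  then obtain M where M: "\<And>m n. m \<ge> M \<Longrightarrow> n \<ge> M \<Longrightarrow> norm (sqrt_iter_bound m - sqrt_iter_bound n) < e"
    using e by (metis CauchyD)
  have "norm (sqrt_iter A m - sqrt_iter A n) < e" if "m \<ge> M" "n \<ge> M" for m n
    using norm_sqrt_iter_diff[OF assms, of m n] norm_sqrt_iter_diff[OF assms, of n m]
      M[OF that] M[OF that(2,1)] by (cases "n \<le> m") (auto simp: norm_minus_commute)
  then show "\<exists>M. \<forall>m\<ge>M. \<forall>n\<ge>M. norm (sqrt_iter A m - sqrt_iter A n) < e" by blast
qed

text \<open>The square root of \<open>D\<^sup>2 = 1 - A\<close> is \<open>1 - Y\<close>, where \<open>Y\<close> is the fixed point of
  \<open>Y \<mapsto> (A + Y\<^sup>2) / 2\<close>.\<close>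
lemma operator_abs_value:
  fixes D :: "'a::{real_inner,banach} \<Rightarrow>\<^sub>L 'a"
  assumes sa: "\<And>f g. inner (D f) g = inner f (D g)" and D: "norm D \<le> 1"
  obtains B where "B o\<^sub>L B = D o\<^sub>L D" "\<And>f. inner (B f) f \<ge> 0"
    "\<And>S. S o\<^sub>L D = D o\<^sub>L S \<Longrightarrow> S o\<^sub>L B = B o\<^sub>L S"
proof -
  define A where "A = id_blinfun - (D o\<^sub>L D)"
  have Dle: "norm (D f) \<le> norm f" for f
    using order_trans[OF norm_blinfun mult_right_mono[OF D norm_ge_zero]] by simp
  \<comment> \<open>Self-adjointness of \<open>D\<close> evaluates the cross term of
    \<open>f - D (D f)\<close> as the squared norm of \<open>D f\<close>, which absorbs the last
    term since \<open>D\<close> is a contraction.\<close>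
  have "norm (A f) \<le> norm f" for f
  proof -
    have "(norm (A f))\<^sup>2 = (norm f)\<^sup>2 - 2 * (norm (D f))\<^sup>2 + (norm (D (D f)))\<^sup>2"
    proof -
      have *: "(norm (x - y))\<^sup>2 = (norm x)\<^sup>2 - 2 * inner x y + (norm y)\<^sup>2" for x y :: 'a
        unfolding power2_norm_eq_inner using inner_commute[of x y]
        by (simp add: inner_diff_left inner_diff_right)
      have "inner f (D (D f)) = (norm (D f))\<^sup>2"
        unfolding power2_norm_eq_inner by (rule sa[symmetric])
      then show ?thesis unfolding A_def using *[of f "D (D f)"] by (simp add: blinfun.bilinear_simps)
    qed
    also have "\<dots> \<le> (norm f)\<^sup>2"
      using power_mono[OF Dle[of "D f"] norm_ge_zero, of 2] zero_le_power2[of "norm (D f)"] by linarith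
    finally show ?thesis by (rule power2_le_imp_le) simp
  qed
  then have A: "norm A \<le> 1" by (intro norm_blinfun_bound) auto
  obtain Y where Y: "sqrt_iter A \<longlonglongrightarrow> Y"
    using Cauchy_sqrt_iter[OF A] Cauchy_convergent_iff convergent_def by blast
  have "(\<lambda>n. sqrt_iter A (Suc n)) \<longlonglongrightarrow> (1/2) *\<^sub>R (A + (Y o\<^sub>L Y))"
    unfolding sqrt_iter.simps
    by (intro tendsto_intros Y bounded_bilinear.tendsto[OF bounded_bilinear_blinfun_compose])
  then have fix_eq: "Y = (1/2) *\<^sub>R (A + (Y o\<^sub>L Y))"
    by (rule LIMSEQ_unique[OF LIMSEQ_Suc[OF Y]])
  have Ynorm: "norm Y \<le> 1"
    using norm_sqrt_iter[OF A] sqrt_iter_bound_range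
    by (intro LIMSEQ_le_const2[OF tendsto_norm[OF Y]]) (meson order_trans)
  define B where "B = id_blinfun - Y"
  have "(B o\<^sub>L B) f = (D o\<^sub>L D) f" for f
  proof -
    have "2 *\<^sub>R Y f = A f + Y (Y f)"
      using arg_cong[OF fix_eq, of "\<lambda>X. 2 *\<^sub>R X f"] by (simp add: blinfun.bilinear_simps)
    then have eq: "Y f + Y f = f - D (D f) + Y (Y f)"
      unfolding A_def by (simp add: scaleR_2 blinfun.bilinear_simps)
    have "(B o\<^sub>L B) f = f + Y (Y f) - (Y f + Y f)"
      unfolding B_def by (simp add: blinfun.bilinear_simps)
    also have "\<dots> = D (D f)" unfolding eq by simp
    finally show ?thesis by simp
  qed
  then have 1: "B o\<^sub>L B = D o\<^sub>L D" by (intro blinfun_eqI) auto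
  have 2: "inner (B f) f \<ge> 0" for f
  proof -
    have "inner (Y f) f \<le> norm (Y f) * norm f" by (rule norm_cauchy_schwarz)
    also have "\<dots> \<le> norm f * norm f"
      using order_trans[OF norm_blinfun mult_right_mono[OF Ynorm norm_ge_zero]]
      by (intro mult_right_mono) auto
    finally show ?thesis
      unfolding B_def by (simp add: blinfun.bilinear_simps inner_diff_left power2_norm_eq_inner[symmetric] power2_eq_square)
  qed
  have 3: "S o\<^sub>L B = B o\<^sub>L S" if S: "S o\<^sub>L D = D o\<^sub>L S" for S
  proof -
    have SD: "S (D f) = D (S f)" for f
      using arg_cong[OF S, of "\<lambda>X. X f"] by simp
    \<comment> \<open>Every iterate is a polynomial in \<open>A\<close>, so commutation with
      \<open>D\<close> passes to the iterates and then to their limit \<open>Y\<close>.\<close>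
    have "S o\<^sub>L sqrt_iter A n = sqrt_iter A n o\<^sub>L S" for n
    proof (induction n)
      case (Suc n)
      have "S (sqrt_iter A n f) = sqrt_iter A n (S f)" for f
        using arg_cong[OF Suc, of "\<lambda>X. X f"] by simp
      then show ?case
        by (intro blinfun_eqI) (simp add: A_def SD blinfun.bilinear_simps)
    qed simp
    then have "(\<lambda>n. S o\<^sub>L sqrt_iter A n) \<longlonglongrightarrow> (Y o\<^sub>L S)"
      using bounded_bilinear.tendsto[OF bounded_bilinear_blinfun_compose Y tendsto_const] by simp
    moreover have "(\<lambda>n. S o\<^sub>L sqrt_iter A n) \<longlonglongrightarrow> (S o\<^sub>L Y)"
      by (intro tendsto_intros Y bounded_bilinear.tendsto[OF bounded_bilinear_blinfun_compose])
    ultimately have "S o\<^sub>L Y = Y o\<^sub>L S" using LIMSEQ_unique by blast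
    from arg_cong[OF this, of "\<lambda>X. blinfun_apply X f" for f] have "S (Y f) = Y (S f)" for f by simp
    then show ?thesis unfolding B_def
      by (intro blinfun_eqI) (simp add: blinfun.bilinear_simps)
  qed
  show thesis using that 1 2 3 by blast
qed

text \<open>With \<open>B = |T - r|\<close> (up to scaling), \<open>V\<close> is the kernel of \<open>(T - r) + B\<close>; since
  \<open>B\<^sup>2 = (T - r)\<^sup>2\<close>, the operator \<open>B - (T - r)\<close> maps into \<open>V\<close>.\<close>
lemma spectral_subspace:
  fixes T :: "'a::{real_inner,banach} \<Rightarrow>\<^sub>L 'a"
  assumes sa: "\<And>f g. inner (T f) g = inner f (T g)"
  obtains V where "subspace V" "closed V"
    "\<And>S f. S o\<^sub>L T = T o\<^sub>L S \<Longrightarrow> f \<in> V \<Longrightarrow> blinfun_apply S f \<in> V"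
    "\<And>f. f \<in> V \<Longrightarrow> inner (T f) f \<le> r * (norm f)\<^sup>2"
    "\<And>f. \<forall>k\<in>V. inner f k = 0 \<Longrightarrow> r * (norm f)\<^sup>2 \<le> inner (T f) f"
proof -
  \<comment> \<open>Rescaling by \<open>M\<close> makes \<open>D\<close> a contraction, as
    \<open>operator_abs_value\<close> requires; the extra 1 keeps \<open>M\<close> positive when
    \<open>T\<close> is \<open>r\<close> times the identity.\<close>
  define M where "M = norm (T - r *\<^sub>R id_blinfun) + 1"
  have M: "M > 0" unfolding M_def by (simp add: add_nonneg_pos)
  define D where "D = inverse M *\<^sub>R (T - r *\<^sub>R id_blinfun)"
  have Dsa: "inner (D f) g = inner f (D g)" for f g
    unfolding D_def by (simp add: blinfun.bilinear_simps inner_diff_left inner_diff_right sa)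
  have "norm D \<le> 1"
    unfolding D_def norm_scaleR using M by (simp add: M_def divide_simps)
  then obtain B where B: "B o\<^sub>L B = D o\<^sub>L D" "\<And>f. inner (B f) f \<ge> 0"
    "\<And>S. S o\<^sub>L D = D o\<^sub>L S \<Longrightarrow> S o\<^sub>L B = B o\<^sub>L S"
    using operator_abs_value[OF Dsa] by blast
  have BD: "B (D f) = D (B f)" for f
    using arg_cong[OF B(3)[of D, OF refl], of "\<lambda>X. X f"] by simp
  have BB: "B (B f) = D (D f)" for f using arg_cong[OF B(1), of "\<lambda>X. X f"] by simp
  define c where "c = B + D"
  define V where "V = {f. blinfun_apply c f = 0}"
  have TD: "inner (T f) f = r * (norm f)\<^sup>2 + M * inner (D f) f" for f
  proof -
    have "M * inner (D f) f = (M * inverse M) * inner (T f - r *\<^sub>R f) f"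
      unfolding D_def by (simp add: blinfun.bilinear_simps)
    then show ?thesis using M by (simp add: inner_diff_left power2_norm_eq_inner)
  qed
  show thesis
  proof (rule that[of V])
    show "subspace V" unfolding V_def subspace_def by (auto simp: blinfun.bilinear_simps)
    show "closed V" unfolding V_def
      by (intro closed_Collect_eq linear_continuous_on blinfun.bounded_linear_right continuous_on_const)
  next
    fix S f assume S: "S o\<^sub>L T = T o\<^sub>L S" and f: "f \<in> V"
    have ST: "S (T g) = T (S g)" for g using arg_cong[OF S, of "\<lambda>X. X g"] by simp
    have SD: "S o\<^sub>L D = D o\<^sub>L S"
      unfolding D_def by (rule blinfun_eqI) (simp add: blinfun.bilinear_simps ST)
    have "S (B f) = B (S f)" "S (D f) = D (S f)"
      using arg_cong[OF B(3)[OF SD], of "\<lambda>X. X f"] arg_cong[OF SD, of "\<lambda>X. X f"] by auto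
    then have "c (S f) = S (c f)" unfolding c_def by (simp add: blinfun.bilinear_simps)
    then show "blinfun_apply S f \<in> V" using f unfolding V_def by (simp add: blinfun.bilinear_simps)
  next
    fix f assume "f \<in> V"
    then have "D f = - B f" unfolding V_def c_def by (simp add: blinfun.bilinear_simps eq_neg_iff_add_eq_0 add.commute)
    then have "inner (D f) f \<le> 0" using B(2)[of f] by simp
    then show "inner (T f) f \<le> r * (norm f)\<^sup>2" using TD[of f] M by (simp add: mult_le_0_iff)
  next
    fix f assume f: "\<forall>k\<in>V. inner f k = 0"
    have "B f - D f \<in> V" unfolding V_def c_def by (simp add: blinfun.bilinear_simps BD BB)
    then have "inner f (B f - D f) = 0" using f by blast
    then have "inner (D f) f = inner (B f) f"
      by (simp add: inner_diff_right inner_commute)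
    then show "r * (norm f)\<^sup>2 \<le> inner (T f) f" using TD[of f] M B(2)[of f] by simp
  qed
qed

section \<open>The Hilbert space of square-summable functions\<close>

lemma l2_iff: "f \<in> l2 UNIV \<longleftrightarrow> (\<lambda>x. (cmod (f x))\<^sup>2) summable_on UNIV"
  by (simp add: l2_def)

lemma l2_scale: "f \<in> l2 UNIV \<Longrightarrow> (\<lambda>x. c * f x) \<in> l2 UNIV"
  unfolding l2_iff norm_mult power_mult_distrib by (rule summable_on_cmult_right)

lemma l2_add:
  assumes "f \<in> l2 UNIV" "g \<in> l2 UNIV"
  shows "(\<lambda>x. f x + g x) \<in> l2 UNIV"
  unfolding l2_iff
proof (rule summable_on_comparison_test)
  show "(\<lambda>x. 2 * (cmod (f x))\<^sup>2 + 2 * (cmod (g x))\<^sup>2) summable_on UNIV"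
    using assms unfolding l2_iff by (intro summable_on_add summable_on_cmult_right)
  show "(cmod (f x + g x))\<^sup>2 \<le> 2 * (cmod (f x))\<^sup>2 + 2 * (cmod (g x))\<^sup>2" for x
  proof -
    have "(cmod (f x + g x))\<^sup>2 \<le> (cmod (f x) + cmod (g x))\<^sup>2"
      by (intro power_mono norm_triangle_ineq) simp
    also have "\<dots> \<le> 2 * (cmod (f x))\<^sup>2 + 2 * (cmod (g x))\<^sup>2"
      using sum_squares_bound[of "cmod (f x)" "cmod (g x)"] by (simp add: power2_sum)
    finally show ?thesis .
  qed
qed simp

lemma l2_product_summable:
  assumes "f \<in> l2 UNIV" "g \<in> l2 UNIV"
  shows "(\<lambda>x. f x * cnj (g x)) summable_on UNIV"
proof (rule abs_summable_summable, rule summable_on_comparison_test)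
  show "(\<lambda>x. (cmod (f x))\<^sup>2 + (cmod (g x))\<^sup>2) summable_on UNIV"
    using assms unfolding l2_iff by (intro summable_on_add)
  show "norm (f x * cnj (g x)) \<le> (cmod (f x))\<^sup>2 + (cmod (g x))\<^sup>2" for x
    using sum_squares_bound[of "cmod (f x)" "cmod (g x)"]
      mult_nonneg_nonneg[OF norm_ge_zero[of "f x"] norm_ge_zero[of "g x"]]
    unfolding norm_mult complex_mod_cnj by linarith
qed simp

lemma l2_finite_support:
  assumes "finite {x. f x \<noteq> 0}"
  shows "f \<in> l2 UNIV"
  unfolding l2_iff
  using has_sum_finite_neutralI[OF assms, of UNIV "\<lambda>x. (cmod (f x))\<^sup>2"]
  by (auto intro: has_sum_imp_summable)

text \<open>As a type with a real inner product (the real part of the complex one),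
  \<open>l2 UNIV\<close> carries the bounded operators \<open>blinfun\<close>. Complex scalars act
  through the operators \<open>cscale\<close>.\<close>

typedef 'a ell2 = "l2 (UNIV :: 'a set)" morphisms coord of_coord
  by (rule exI[of _ "\<lambda>_. 0"]) (simp add: l2_finite_support)

lemma ell2_eqI: "(\<And>x. coord f x = coord g x) \<Longrightarrow> f = g"
  using coord_inject by blast

instantiation ell2 :: (type) real_inner
begin

definition "0 = of_coord (\<lambda>_. 0)"
definition "f + g = of_coord (\<lambda>x. coord f x + coord g x)"
definition "- f = of_coord (\<lambda>x. - 1 * coord f x)"
definition "f - g = of_coord (\<lambda>x. coord f x + - 1 * coord g x)"
definition "r *\<^sub>R f = of_coord (\<lambda>x. of_real r * coord f x)"
definition "inner f g = Re (l2_inner UNIV (coord f) (coord g))"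
definition norm_ell2_def: "norm (f :: 'a ell2) = sqrt (inner f f)"
definition dist_ell2_def: "dist (f :: 'a ell2) g = norm (f - g)"
definition sgn_ell2_def: "sgn (f :: 'a ell2) = inverse (norm f) *\<^sub>R f"
definition uniformity_ell2_def: "(uniformity :: ('a ell2 \<times> 'a ell2) filter)
  = (INF e\<in>{0<..}. principal {(x, y). dist x y < e})"
definition open_ell2_def: "open (U :: 'a ell2 set)
  \<longleftrightarrow> (\<forall>x\<in>U. eventually (\<lambda>(x', y). x' = x \<longrightarrow> y \<in> U) uniformity)"

lemma coord_zero: "coord 0 x = 0"
  by (simp add: zero_ell2_def of_coord_inverse l2_finite_support)

lemma coord_add: "coord (f + g) x = coord f x + coord g x"
  by (simp add: plus_ell2_def of_coord_inverse l2_add coord)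

lemma coord_uminus: "coord (- f) x = - coord f x"
  using l2_scale[OF coord[of f], of "-1"] by (simp add: uminus_ell2_def of_coord_inverse)

lemma coord_diff: "coord (f - g) x = coord f x - coord g x"
  using l2_add[OF coord[of f] l2_scale[OF coord[of g], of "-1"]]
  by (simp add: minus_ell2_def of_coord_inverse)

lemma coord_scaleR: "coord (r *\<^sub>R f) x = of_real r * coord f x"
  by (simp add: scaleR_ell2_def of_coord_inverse l2_scale coord)

lemma Re_complex_of_real_mult: "Re (complex_of_real r * z) = r * Re z"
  by simp

lemma inner_ell2: "inner f g = infsum (\<lambda>x. Re (coord f x * cnj (coord g x))) UNIV"
  unfolding inner_ell2_def l2_inner_def
  by (rule infsum_Re[symmetric]) (intro l2_product_summable coord)

lemma inner_ell2_summable: "(\<lambda>x. Re (coord f x * cnj (coord g x))) summable_on UNIV"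
  by (intro summable_on_Re l2_product_summable coord)

lemma inner_ell2_self: "inner f f = infsum (\<lambda>x. (cmod (coord f x))\<^sup>2) UNIV"
  unfolding inner_ell2 by (simp only: complex_norm_square[symmetric] Re_complex_of_real)

instance
proof
  fix f g h :: "'a ell2" and r s :: real
  show "f + g + h = f + (g + h)" "f + g = g + f" "0 + f = f" "- f + f = 0" "f - g = f + - g"
    "r *\<^sub>R (f + g) = r *\<^sub>R f + r *\<^sub>R g" "(r + s) *\<^sub>R f = r *\<^sub>R f + s *\<^sub>R f"
    "r *\<^sub>R s *\<^sub>R f = (r * s) *\<^sub>R f" "1 *\<^sub>R f = f"
    by (auto intro!: ell2_eqI simp: coord_zero coord_add coord_uminus coord_diff coord_scaleR
        algebra_simps)
  show "inner f g = inner g f"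
    unfolding inner_ell2 by (simp add: mult.commute)
  show "inner (f + g) h = inner f h + inner g h"
    unfolding inner_ell2 coord_add distrib_right plus_complex.sel
    by (intro infsum_add inner_ell2_summable)
  show "inner (r *\<^sub>R f) g = r * inner f g"
    unfolding inner_ell2 coord_scaleR mult.assoc Re_complex_of_real_mult
    by (rule infsum_cmult_right')
  show "0 \<le> inner f f"
    unfolding inner_ell2_self by (intro infsum_nonneg) simp
  show "inner f f = 0 \<longleftrightarrow> f = 0"
  proof
    assume "inner f f = 0"
    then have "(cmod (coord f x))\<^sup>2 = 0" for x
      unfolding inner_ell2_self
      by (intro nonneg_infsum_le_0D[where A = UNIV and f = "\<lambda>x. (cmod (coord f x))\<^sup>2"])
        (use coord[of f] in \<open>auto simp: l2_iff\<close>)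
    then show "f = 0" by (intro ell2_eqI) (simp add: coord_zero)
  qed (simp add: inner_ell2_self coord_zero)
qed (simp_all add: norm_ell2_def dist_ell2_def sgn_ell2_def uniformity_ell2_def open_ell2_def)

end

lemma coord_sum: "coord (sum F S) x = (\<Sum>s\<in>S. coord (F s) x)"
  by (induction S rule: infinite_finite_induct) (auto simp: coord_zero coord_add)

lemma norm_ell2_l2_norm: "norm f = l2_norm UNIV (coord f)"
  by (simp add: norm_ell2_def inner_ell2_self l2_norm_def)

lemma norm_ell2_sq: "(norm f)\<^sup>2 = infsum (\<lambda>x. (cmod (coord f x))\<^sup>2) UNIV"
  by (simp add: power2_norm_eq_inner inner_ell2_self)

lemma ell2_sum_le_norm:
  assumes "finite S"
  shows "(\<Sum>x\<in>S. (cmod (coord f x))\<^sup>2) \<le> (norm f)\<^sup>2"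
  unfolding norm_ell2_sq using assms coord[of f] by (intro finite_sum_le_infsum) (auto simp: l2_iff)

lemma cmod_coord_le: "cmod (coord f x) \<le> norm f"
  by (rule power2_le_imp_le) (use ell2_sum_le_norm[of "{x}" f] in simp_all)

instance ell2 :: (type) banach
proof
  fix X :: "nat \<Rightarrow> 'a ell2" assume X: "Cauchy X"
  have "Cauchy (\<lambda>n. coord (X n) x)" for x
  proof (rule CauchyI)
    fix e :: real assume "e > 0"
    then obtain M where M: "\<And>m n. m \<ge> M \<Longrightarrow> n \<ge> M \<Longrightarrow> norm (X m - X n) < e"
      using CauchyD[OF X] by metis
    have "norm (coord (X m) x - coord (X n) x) < e" if "m \<ge> M" "n \<ge> M" for m n
      using le_less_trans[OF cmod_coord_le M[OF that], of x] by (simp add: coord_diff)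
    then show "\<exists>M. \<forall>m\<ge>M. \<forall>n\<ge>M. norm (coord (X m) x - coord (X n) x) < e" by blast
  qed
  then have "\<exists>l. (\<lambda>n. coord (X n) x) \<longlonglongrightarrow> l" for x
    using Cauchy_convergent unfolding convergent_def by blast
  then obtain F where F: "\<And>x. (\<lambda>n. coord (X n) x) \<longlonglongrightarrow> F x"
    by metis
  \<comment> \<open>Letting \<open>m\<close> tend to infinity in finite sums gives a bound uniform
    in \<open>S\<close>. It serves twice: to put \<open>F\<close> in \<open>l2 UNIV\<close> and to
    obtain convergence in norm.\<close>
  have bound: "(\<Sum>x\<in>S. (cmod (F x - coord (X n) x))\<^sup>2) \<le> e\<^sup>2"
    if "finite S" and n: "\<And>m. m \<ge> n \<Longrightarrow> norm (X m - X n) < e" for S n e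
  proof (rule LIMSEQ_le_const2)
    show "(\<lambda>m. \<Sum>x\<in>S. (cmod (coord (X m) x - coord (X n) x))\<^sup>2)
        \<longlonglongrightarrow> (\<Sum>x\<in>S. (cmod (F x - coord (X n) x))\<^sup>2)"
      by (intro tendsto_intros F)
    have "(\<Sum>x\<in>S. (cmod (coord (X m) x - coord (X n) x))\<^sup>2) \<le> e\<^sup>2" if "m \<ge> n" for m
      using ell2_sum_le_norm[OF \<open>finite S\<close>, of "X m - X n"]
        power_mono[OF less_imp_le[OF n[OF that]] norm_ge_zero, of 2]
      by (simp add: coord_diff)
    then show "\<exists>N. \<forall>m\<ge>N. (\<Sum>x\<in>S. (cmod (coord (X m) x - coord (X n) x))\<^sup>2) \<le> e\<^sup>2" by blast
  qed
  have l2diff: "(\<lambda>x. F x - coord (X n) x) \<in> l2 UNIV"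
    if n: "\<And>m. m \<ge> n \<Longrightarrow> norm (X m - X n) < e" for n e
    unfolding l2_iff
    by (rule nonneg_bdd_above_summable_on) (auto intro!: bdd_aboveI2[of _ _ "e\<^sup>2"] bound n)
  obtain n1 where n1: "\<And>m. m \<ge> n1 \<Longrightarrow> norm (X m - X n1) < 1"
    using CauchyD[OF X, of 1] by (metis order_refl zero_less_one)
  have "F \<in> l2 UNIV"
    using l2_add[OF l2diff[OF n1] coord[of "X n1"]] by simp
  then have cF: "coord (of_coord F) = F" by (rule of_coord_inverse)
  have "X \<longlonglongrightarrow> of_coord F"
  proof (rule LIMSEQ_I)
    fix e :: real assume e: "e > 0"
    then obtain M where M: "\<And>m n. m \<ge> M \<Longrightarrow> n \<ge> M \<Longrightarrow> norm (X m - X n) < e / 2"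
      using CauchyD[OF X, of "e/2"] by (metis half_gt_zero)
    have "norm (X n - of_coord F) < e" if n: "n \<ge> M" for n
    proof -
      have n': "norm (X m - X n) < e / 2" if "m \<ge> n" for m using M that n by simp
      have "(norm (of_coord F - X n))\<^sup>2 \<le> (e / 2)\<^sup>2"
        unfolding norm_ell2_sq
        using l2diff[OF n'] bound[OF _ n']
        by (intro infsum_le_finite_sums) (auto simp: coord_diff cF l2_iff)
      then have "norm (of_coord F - X n) \<le> e / 2" by (rule power2_le_imp_le) (use e in simp)
      also have "\<dots> < e" using e by simp
      finally show ?thesis unfolding norm_minus_commute[of "X n"] .
    qed
    then show "\<exists>M. \<forall>n\<ge>M. norm (X n - of_coord F) < e" by blast
  qed
  then show "convergent X" unfolding convergent_def by blast
qed

section \<open>Complex scalars, the complex inner product and basis vectors\<close>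

definition cscale :: "complex \<Rightarrow> 'a ell2 \<Rightarrow>\<^sub>L 'a ell2" where
  "cscale c = Blinfun (\<lambda>f. of_coord (\<lambda>x. c * coord f x))"

lemma coord_cscale: "coord (cscale c f) x = c * coord f x"
proof -
  define F where "F = (\<lambda>f. of_coord (\<lambda>x. c * coord f x) :: 'a ell2)"
  have F: "coord (F f) x = c * coord f x" for f x
    unfolding F_def by (simp add: of_coord_inverse l2_scale coord)
  have "bounded_linear F"
  proof (rule bounded_linear_intro)
    fix f g :: "'a ell2" and r :: real
    show "F (f + g) = F f + F g" "F (r *\<^sub>R f) = r *\<^sub>R F f"
      by (auto intro!: ell2_eqI simp: F coord_add coord_scaleR algebra_simps)
    have "(norm (F f))\<^sup>2 = (cmod c)\<^sup>2 * (norm f)\<^sup>2"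
      unfolding norm_ell2_sq F norm_mult power_mult_distrib by (rule infsum_cmult_right')
    then have "norm (F f) = cmod c * norm f"
      by (metis norm_ge_zero power2_eq_imp_eq power_mult_distrib mult_nonneg_nonneg)
    then show "norm (F f) \<le> norm f * cmod c" by (simp add: mult.commute)
  qed
  then have "blinfun_apply (cscale c) = F"
    unfolding cscale_def F_def by (rule bounded_linear_Blinfun_apply)
  then show ?thesis using F by simp
qed

lemma norm_cscale: "norm (cscale c f) = cmod c * norm f"
proof -
  have "(norm (cscale c f))\<^sup>2 = (cmod c)\<^sup>2 * (norm f)\<^sup>2"
    unfolding norm_ell2_sq coord_cscale norm_mult power_mult_distrib by (rule infsum_cmult_right')
  then show ?thesis
    by (metis norm_ge_zero power2_eq_imp_eq power_mult_distrib mult_nonneg_nonneg)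
qed

lemma inner_cscale: "inner (cscale c f) g = inner f (cscale (cnj c) g)"
  unfolding inner_ell2 coord_cscale by (intro infsum_cong) (simp add: algebra_simps)

text \<open>The imaginary part of a complex number is the real part of its product with
  \<open>- \<i>\<close>, so the real inner product determines the complex one.\<close>

lemma l2_inner_coord:
  "l2_inner UNIV (coord f) (coord g) = Complex (inner f g) (inner (cscale (- \<i>) f) g)"
proof (rule complex_eqI)
  have "l2_inner UNIV (coord (cscale (- \<i>) f)) (coord g) = - \<i> * l2_inner UNIV (coord f) (coord g)"
    unfolding l2_inner_def coord_cscale
    by (subst infsum_cmult_right[symmetric]) (auto intro!: l2_product_summable coord infsum_cong)
  then show "Im (l2_inner UNIV (coord f) (coord g))
      = Im (Complex (inner f g) (inner (cscale (- \<i>) f) g))"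
    by (simp add: inner_ell2_def)
qed (simp add: inner_ell2_def)

definition basis :: "'a \<Rightarrow> 'a ell2" where
  "basis x = of_coord (\<lambda>y. if y = x then 1 else 0)"

lemma coord_basis: "coord (basis x) y = (if y = x then 1 else 0)"
  unfolding basis_def by (subst of_coord_inverse) (auto intro!: l2_finite_support)

lemma inner_basis: "inner f (basis x) = Re (coord f x)"
proof -
  have "((\<lambda>y. Re (coord f y * cnj (coord (basis x) y))) has_sum Re (coord f x)) UNIV"
    by (rule has_sum_finite_neutralI[of "{x}"]) (auto simp: coord_basis)
  then show ?thesis unfolding inner_ell2 by (rule infsumI)
qed

lemma norm_basis: "norm (basis x) = 1"
  by (simp add: norm_eq_sqrt_inner inner_basis coord_basis)

section \<open>The left regular representation and its restrictions\<close>

lemma grp_alg_UNIV: "a \<in> grp_alg UNIV \<longleftrightarrow> finite {x. a x \<noteq> 0}"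
  by (simp add: grp_alg_def)

lemma bij_add_left: "bij (\<lambda>x. g + x)" for g :: "'g::group_add"
  by (rule bij_betw_byWitness[of _ "\<lambda>x. - g + x"]) (auto simp: add.assoc[symmetric])

lemma bij_add_right: "bij (\<lambda>x. x + g)" for g :: "'g::group_add"
  by (rule bij_betw_byWitness[of _ "\<lambda>x. x + - g"]) (auto simp: add.assoc simp del: add_uminus_conv_diff)

definition transl :: "'g::group_add \<Rightarrow> 'g ell2 \<Rightarrow>\<^sub>L 'g ell2" where
  "transl g = Blinfun (\<lambda>f. of_coord (\<lambda>x. coord f (- g + x)))"

lemma coord_transl: "coord (transl g f) x = coord f (- g + x)"
proof -
  define F where "F = (\<lambda>f. of_coord (\<lambda>x. coord f (- g + x)) :: 'a ell2)"
  have F: "coord (F f) x = coord f (- g + x)" for f x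
    unfolding F_def using coord[of f]
    by (subst of_coord_inverse)
      (auto simp: l2_iff summable_on_reindex_bij_betw[OF bij_add_left, of "\<lambda>x. (cmod (coord f x))\<^sup>2"])
  have "bounded_linear F"
  proof (rule bounded_linear_intro)
    fix f h :: "'a ell2" and r :: real
    show "F (f + h) = F f + F h" "F (r *\<^sub>R f) = r *\<^sub>R F f"
      by (auto intro!: ell2_eqI simp: F coord_add coord_scaleR)
    have "(norm (F f))\<^sup>2 = (norm f)\<^sup>2"
      unfolding norm_ell2_sq F
      by (rule infsum_reindex_bij_betw[OF bij_add_left, of "\<lambda>x. (cmod (coord f x))\<^sup>2"])
    then show "norm (F f) \<le> norm f * 1" by simp
  qed
  then have "blinfun_apply (transl g) = F"
    unfolding transl_def F_def by (rule bounded_linear_Blinfun_apply)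
  then show ?thesis using F by simp
qed

lemma inner_transl: "inner (transl g f) h = inner f (transl (- g) h)"
  unfolding inner_ell2 coord_transl
  using infsum_reindex_bij_betw[OF bij_add_left, of "\<lambda>x. Re (coord f (- g + x) * cnj (coord h x))" g]
  by (simp add: add.assoc[symmetric])

lemma transl_add: "transl (g + h) f = transl g (transl h f)"
  by (rule ell2_eqI) (simp only: coord_transl minus_add add.assoc)

lemma transl_zero: "transl 0 f = f"
  by (rule ell2_eqI) (simp add: coord_transl)

lemma transl_cancel: "transl g (transl (- g) f) = f" "transl (- g) (transl g f) = f"
  by (simp_all add: transl_add[symmetric] transl_zero)

lemma transl_basis: "transl g (basis h) = basis (g + h)"
proof (rule ell2_eqI)
  fix x
  have "- g + x = h \<longleftrightarrow> x = g + h" by (metis add.assoc add.left_inverse add_0 add.right_inverse)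
  then show "coord (transl g (basis h)) x = coord (basis (g + h)) x"
    by (simp add: coord_transl coord_basis)
qed

lemma inner_transl_transl: "inner (transl g f) (transl g h) = inner f h"
  by (simp add: inner_transl transl_add[symmetric] transl_zero)

text \<open>This is \<open>lreg UNIV a\<close>, written as a sum of scaled translations so that
  boundedness is built in.\<close>

definition lrep :: "('g::group_add \<Rightarrow> complex) \<Rightarrow> 'g ell2 \<Rightarrow>\<^sub>L 'g ell2" where
  "lrep a = (\<Sum>g\<in>{y. a y \<noteq> 0}. cscale (a g) o\<^sub>L transl g)"

lemma blinfun_sum_apply: "blinfun_apply (sum F S) f = (\<Sum>s\<in>S. blinfun_apply (F s) f)"
  by (induction S rule: infinite_finite_induct) (auto simp: blinfun.bilinear_simps)

lemma lrep_apply: "lrep a f = (\<Sum>g\<in>{y. a y \<noteq> 0}. cscale (a g) (transl g f))"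
  unfolding lrep_def by (simp add: blinfun_sum_apply)

lemma coord_lrep: "coord (lrep a f) x = (\<Sum>g\<in>{y. a y \<noteq> 0}. a g * coord f (- g + x))"
  by (simp add: lrep_apply coord_sum coord_cscale coord_transl)

lemma coord_lrep_lreg: "coord (lrep a f) = lreg UNIV a (coord f)"
  by (rule ext) (simp add: coord_lrep lreg_def)

lemma coord_lrep_superset:
  assumes "finite S" "{y. a y \<noteq> 0} \<subseteq> S"
  shows "coord (lrep a f) x = (\<Sum>g\<in>S. a g * coord f (- g + x))"
  unfolding coord_lrep by (rule sum.mono_neutral_left) (use assms in auto)

lemma lrep_add:
  assumes "a \<in> grp_alg UNIV" "b \<in> grp_alg UNIV"
  shows "lrep (\<lambda>x. a x + b x) f = lrep a f + lrep b f"
proof (rule ell2_eqI)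
  fix x
  let ?S = "{y. a y \<noteq> 0} \<union> {y. b y \<noteq> 0}"
  have "finite ?S" using assms by (simp add: grp_alg_UNIV)
  note sup = coord_lrep_superset[OF this]
  have "{y. a y + b y \<noteq> 0} \<subseteq> ?S" by auto
  then show "coord (lrep (\<lambda>x. a x + b x) f) x = coord (lrep a f + lrep b f) x"
    by (simp add: coord_add sup sum.distrib[symmetric] distrib_right)
qed

lemma grp_alg_add:
  "a \<in> grp_alg UNIV \<Longrightarrow> b \<in> grp_alg UNIV \<Longrightarrow> (\<lambda>x. a x + b x) \<in> grp_alg UNIV"
  unfolding grp_alg_UNIV
  by (rule finite_subset[of _ "{y. a y \<noteq> 0} \<union> {y. b y \<noteq> 0}"]) auto

lemma lrep_scale: "lrep (\<lambda>x. c * a x) f = cscale c (lrep a f)"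
proof (cases "c = 0")
  case True
  then show ?thesis by (intro ell2_eqI) (simp add: coord_lrep coord_cscale)
next
  case False
  then show ?thesis
    by (intro ell2_eqI) (simp add: coord_lrep coord_cscale sum_distrib_left mult.assoc)
qed

lemma lrep_cscale: "lrep a (cscale c f) = cscale c (lrep a f)"
  by (intro ell2_eqI) (simp add: coord_lrep coord_cscale sum_distrib_left algebra_simps)

lemma conv_support:
  "{x. conv a b x \<noteq> 0} \<subseteq> (\<lambda>(g, h). g + h) ` ({y. a y \<noteq> 0} \<times> {y. b y \<noteq> 0})"
proof
  fix x assume "x \<in> {x. conv a b x \<noteq> 0}"
  then obtain g where g: "a g \<noteq> 0" "a g * b (- g + x) \<noteq> 0"
    unfolding conv_def by (auto elim: sum.not_neutral_contains_not_neutral)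
  have "x = g + (- g + x)" by (simp add: add.assoc[symmetric])
  then show "x \<in> (\<lambda>(g, h). g + h) ` ({y. a y \<noteq> 0} \<times> {y. b y \<noteq> 0})"
    using g by (intro image_eqI[of _ _ "(g, - g + x)"]) auto
qed

lemma grp_alg_conv:
  "a \<in> grp_alg UNIV \<Longrightarrow> b \<in> grp_alg UNIV \<Longrightarrow> conv a b \<in> grp_alg UNIV"
  unfolding grp_alg_UNIV by (rule finite_subset[OF conv_support]) auto

lemma lrep_conv:
  assumes a: "a \<in> grp_alg UNIV" and b: "b \<in> grp_alg UNIV"
  shows "lrep (conv a b) f = lrep a (lrep b f)"
proof (rule ell2_eqI)
  fix x
  define A B where "A = {y. a y \<noteq> 0}" and "B = {y. b y \<noteq> 0}"
  \<comment> \<open>\<open>S\<close> contains the support of \<open>conv a b\<close> and every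
    \<open>g + B\<close> with \<open>g\<close> in \<open>A\<close>, so one finite index set serves
    for the whole double sum; beyond \<open>g + B\<close> the terms vanish.\<close>
  define S where "S = (\<lambda>(g, h). g + h) ` (A \<times> B)"
  have fin: "finite A" "finite B" using a b by (auto simp: grp_alg_UNIV A_def B_def)
  then have S: "finite S" unfolding S_def by auto
  have inner_sum: "(\<Sum>k\<in>S. b (- g + k) * coord f (- k + x)) = (\<Sum>h\<in>B. b h * coord f (- h + (- g + x)))"
    if g: "g \<in> A" for g
  proof -
    have "(\<Sum>k\<in>S. b (- g + k) * coord f (- k + x))
        = (\<Sum>k\<in>(\<lambda>h. g + h) ` B. b (- g + k) * coord f (- k + x))"
    proof (rule sum.mono_neutral_right[OF S])
      show "(\<lambda>h. g + h) ` B \<subseteq> S" unfolding S_def using g by auto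
      show "\<forall>k\<in>S - (\<lambda>h. g + h) ` B. b (- g + k) * coord f (- k + x) = 0"
      proof
        fix k assume k: "k \<in> S - (\<lambda>h. g + h) ` B"
        have "k = g + (- g + k)" by (simp add: add.assoc[symmetric])
        then have "- g + k \<notin> B" using k by blast
        then show "b (- g + k) * coord f (- k + x) = 0" unfolding B_def by simp
      qed
    qed
    also have "\<dots> = (\<Sum>h\<in>B. b h * coord f (- h + (- g + x)))"
      by (subst sum.reindex) (auto simp: inj_on_def add.assoc[symmetric] minus_add)
    finally show ?thesis .
  qed
  have "coord (lrep (conv a b) f) x = (\<Sum>k\<in>S. conv a b k * coord f (- k + x))"
    using conv_support[of a b] S by (intro coord_lrep_superset) (auto simp: S_def A_def B_def)
  also have "\<dots> = (\<Sum>k\<in>S. \<Sum>g\<in>A. a g * (b (- g + k) * coord f (- k + x)))"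
    by (simp add: conv_def A_def sum_distrib_right mult.assoc)
  also have "\<dots> = (\<Sum>g\<in>A. a g * (\<Sum>k\<in>S. b (- g + k) * coord f (- k + x)))"
    by (subst sum.swap) (simp add: sum_distrib_left)
  also have "\<dots> = (\<Sum>g\<in>A. a g * (\<Sum>h\<in>B. b h * coord f (- h + (- g + x))))"
    by (intro sum.cong) (auto simp: inner_sum)
  also have "\<dots> = coord (lrep a (lrep b f)) x"
    by (simp add: coord_lrep A_def B_def)
  finally show "coord (lrep (conv a b) f) x = coord (lrep a (lrep b f)) x" .
qed

lemma inv_star_support: "{x. inv_star a x \<noteq> 0} = uminus ` {x. a x \<noteq> 0}"
  by (auto simp: inv_star_def intro: image_eqI[of _ _ "- _"])

lemma grp_alg_inv_star: "a \<in> grp_alg UNIV \<Longrightarrow> inv_star a \<in> grp_alg UNIV"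
  unfolding grp_alg_UNIV inv_star_support by simp

lemma inv_star_inv_star: "inv_star (inv_star a) = a"
  by (simp add: inv_star_def)

lemma inner_lrep: "inner (lrep a f) h = inner f (lrep (inv_star a) h)"
proof -
  have comm: "cscale c (transl g h) = transl g (cscale c h)" for c g
    by (rule ell2_eqI) (simp add: coord_cscale coord_transl)
  have "lrep (inv_star a) h = (\<Sum>g\<in>{x. a x \<noteq> 0}. cscale (cnj (a g)) (transl (- g) h))"
    unfolding lrep_apply inv_star_support
    by (subst sum.reindex) (auto simp: inv_star_def inj_on_def)
  then show ?thesis
    by (simp add: lrep_apply inner_sum_left inner_sum_right inner_cscale inner_transl comm)
qed

definition single :: "'g \<Rightarrow> 'g \<Rightarrow> complex" where
  "single h = (\<lambda>x. if x = h then 1 else 0)"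

lemma delta_e_single: "delta_e = single 0"
  by (simp add: delta_e_def single_def)

lemma single_grp_alg: "h \<in> H \<Longrightarrow> single h \<in> grp_alg H"
  by (auto simp: single_def grp_alg_def)

lemma lrep_single: "lrep (single g) = transl g"
  by (intro blinfun_eqI ell2_eqI) (simp add: coord_lrep coord_transl single_def)

lemma coord_lrep_basis:
  assumes "a \<in> grp_alg UNIV"
  shows "coord (lrep a (basis h)) x = a (x - h)"
proof -
  have "coord (lrep a (basis h)) x = (\<Sum>g\<in>insert (x - h) {y. a y \<noteq> 0}. a g * coord (basis h) (- g + x))"
    using assms by (intro coord_lrep_superset) (auto simp: grp_alg_UNIV)
  also have "\<dots> = (\<Sum>g\<in>insert (x - h) {y. a y \<noteq> 0}. if g = x - h then a g else 0)"
  proof (intro sum.cong refl)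
    fix g
    have "- g + x = h \<longleftrightarrow> g = x - h"
      by (metis add.assoc add.left_inverse add_0 add_diff_cancel diff_add_cancel minus_add_cancel)
    then show "a g * coord (basis h) (- g + x) = (if g = x - h then a g else 0)"
      by (simp add: coord_basis)
  qed
  also have "\<dots> = a (x - h)"
    using assms by (simp add: grp_alg_UNIV sum.delta)
  finally show ?thesis .
qed

text \<open>Conjugation by \<open>h\<close> permutes the support of \<open>z\<close> and preserves
  its values, so reindexing the sum along it moves the translation across.\<close>

lemma lrep_transl_class:
  assumes z: "\<And>x. z (- h + x + h) = z x"
  shows "lrep z (transl h f) = transl h (lrep z f)"
proof (rule ell2_eqI)
  fix x
  have bij: "bij_betw (\<lambda>g. - h + g + h) {y. z y \<noteq> 0} {y. z y \<noteq> 0}"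
  proof (rule bij_betw_byWitness[of _ "\<lambda>g. h + g + - h"])
    have inv: "- h + (h + g + - h) + h = g" "h + (- h + g + h) + - h = g" for g
      by (simp_all only: add.assoc minus_add_cancel add_minus_cancel left_minus right_minus add_0_right)
    show "\<forall>g\<in>{y. z y \<noteq> 0}. h + (- h + g + h) + - h = g"
      "\<forall>g\<in>{y. z y \<noteq> 0}. - h + (h + g + - h) + h = g"
      using inv by blast+
    show "(\<lambda>g. - h + g + h) ` {y. z y \<noteq> 0} \<subseteq> {y. z y \<noteq> 0}" using z by auto
    have "z (h + g + - h) = z g" for g using z[of "h + g + - h"] unfolding inv by simp
    then show "(\<lambda>g. h + g + - h) ` {y. z y \<noteq> 0} \<subseteq> {y. z y \<noteq> 0}"
      by auto
  qed
  have arg: "- (- h + g + h) + (- h + x) = - h + (- g + x)" for g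
    unfolding minus_add minus_minus add.assoc add_minus_cancel ..
  show "coord (lrep z (transl h f)) x = coord (transl h (lrep z f)) x"
    using sum.reindex_bij_betw[OF bij, of "\<lambda>g. z g * coord f (- g + (- h + x))"]
    by (simp add: coord_lrep coord_transl z arg)
qed

text \<open>\<open>lrep a\<close> sends a basis vector to a right translate of \<open>a\<close>,
  which has the same norm as \<open>a\<close>. For a truncation of \<open>f\<close> this gives a
  bound that does not depend on \<open>h\<close>.\<close>

lemma norm_lrep_basis_le:
  assumes a: "a \<in> grp_alg UNIV" and le: "\<And>x. cmod (a x) \<le> cmod (coord f x)"
  shows "norm (lrep a (basis h)) \<le> norm f"
proof (rule power2_le_imp_le)
  have aU: "a \<in> l2 UNIV" using a by (simp add: grp_alg_UNIV l2_finite_support)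
  have "bij (\<lambda>x. x - h)" using bij_add_right[of "- h"] by simp
  then have "(norm (lrep a (basis h)))\<^sup>2 = infsum (\<lambda>x. (cmod (a x))\<^sup>2) UNIV"
    unfolding norm_ell2_sq coord_lrep_basis[OF a] by (rule infsum_reindex_bij_betw)
  also have "\<dots> \<le> (norm f)\<^sup>2"
    unfolding norm_ell2_sq using aU coord[of f]
    by (intro infsum_mono power_mono le) (auto simp: l2_iff)
  finally show "(norm (lrep a (basis h)))\<^sup>2 \<le> (norm f)\<^sup>2" .
qed simp

lemma ex_lrep_sum:
  assumes "finite I" "\<And>i. i \<in> I \<Longrightarrow> \<exists>a\<in>grp_alg UNIV. F i = lrep a"
  shows "\<exists>a\<in>grp_alg UNIV. sum F I = lrep a"
  using assms
proof (induction I rule: finite_induct)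
  case empty
  have "lrep (\<lambda>x. 0) = 0" by (simp add: lrep_def)
  then show ?case by (intro bexI[of _ "\<lambda>x. 0"]) (auto simp: grp_alg_UNIV)
next
  case (insert i I)
  then obtain a b where "a \<in> grp_alg UNIV" "F i = lrep a" "b \<in> grp_alg UNIV" "sum F I = lrep b"
    by blast
  then show ?case
    using insert.hyps by (intro bexI[of _ "\<lambda>x. a x + b x"] grp_alg_add)
      (auto intro!: blinfun_eqI simp: lrep_add blinfun.bilinear_simps)
qed

section \<open>Operator norms of restrictions to a subspace\<close>

definition restricted_norm :: "'g ell2 set \<Rightarrow> ('g::group_add \<Rightarrow> complex) \<Rightarrow> real" where
  "restricted_norm V a = Sup {norm (lrep a f) | f. f \<in> V \<and> norm f \<le> 1}"

lemma reduced_norm_eq: "reduced_norm a = restricted_norm UNIV a"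
proof -
  have "{l2_norm UNIV (lreg UNIV a f) | f. f \<in> l2 UNIV \<and> l2_norm UNIV f \<le> 1}
      = {norm (lrep a f) | f. f \<in> UNIV \<and> norm f \<le> 1}"
  proof (intro set_eqI iffI; clarsimp)
    fix f :: "'a \<Rightarrow> complex" assume f: "f \<in> l2 UNIV" "l2_norm UNIV f \<le> 1"
    then show "\<exists>h. l2_norm UNIV (lreg UNIV a f) = norm (lrep a h) \<and> norm h \<le> 1"
      by (intro exI[of _ "of_coord f"])
        (simp add: norm_ell2_l2_norm coord_lrep_lreg of_coord_inverse)
  next
    fix h :: "'a ell2" assume "norm h \<le> 1"
    then show "\<exists>f. norm (lrep a h) = l2_norm UNIV (lreg UNIV a f) \<and> f \<in> l2 UNIV \<and> l2_norm UNIV f \<le> 1"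
      by (intro exI[of _ "coord h"]) (simp add: norm_ell2_l2_norm coord_lrep_lreg coord)
  qed
  then show ?thesis unfolding reduced_norm_def restricted_norm_def by simp
qed

lemma restricted_norm_bdd: "bdd_above {norm (lrep a f) | f. f \<in> V \<and> norm f \<le> 1}"
proof (rule bdd_aboveI)
  fix y assume "y \<in> {norm (lrep a f) | f. f \<in> V \<and> norm f \<le> 1}"
  then obtain h where h: "y = norm (lrep a h)" "norm h \<le> 1" by blast
  have "norm (lrep a h) \<le> norm (lrep a) * norm h" by (rule norm_blinfun)
  also have "\<dots> \<le> norm (lrep a)" using h(2) by (simp add: mult_left_le)
  finally show "y \<le> norm (lrep a)" using h(1) by simp
qed

lemma norm_le_restricted_norm:
  assumes V: "subspace V" and f: "f \<in> V"
  shows "norm (lrep a f) \<le> restricted_norm V a * norm f"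
proof (cases "f = 0")
  case False
  let ?u = "inverse (norm f) *\<^sub>R f"
  have "?u \<in> V" "norm ?u \<le> 1" using False subspace_scale[OF V f] by auto
  then have "norm (lrep a ?u) \<le> restricted_norm V a"
    unfolding restricted_norm_def by (intro cSup_upper[OF _ restricted_norm_bdd]) blast
  then show ?thesis using False by (simp add: blinfun.bilinear_simps field_simps)
qed (simp add: blinfun.bilinear_simps)

lemma restricted_norm_le:
  assumes V: "subspace V" and c: "c \<ge> 0" and le: "\<And>f. f \<in> V \<Longrightarrow> norm (lrep a f) \<le> c * norm f"
  shows "restricted_norm V a \<le> c"
  unfolding restricted_norm_def
proof (rule cSup_least)
  show "{norm (lrep a f) | f. f \<in> V \<and> norm f \<le> 1} \<noteq> {}"
    using subspace_0[OF V] by (auto intro!: exI[of _ 0])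
  fix y assume "y \<in> {norm (lrep a f) | f. f \<in> V \<and> norm f \<le> 1}"
  then obtain f where f: "y = norm (lrep a f)" "f \<in> V" "norm f \<le> 1" by blast
  have "c * norm f \<le> c" using c f(3) by (simp add: mult_left_le)
  then show "y \<le> c" using le[OF f(2)] f(1) by simp
qed

lemma restricted_norm_nonneg:
  assumes V: "subspace V"
  shows "restricted_norm V a \<ge> 0"
  unfolding restricted_norm_def
proof (rule cSup_upper)
  show "0 \<in> {norm (lrep a f) | f. f \<in> V \<and> norm f \<le> 1}"
    using subspace_0[OF V] by (auto simp: blinfun.bilinear_simps intro!: exI[of _ 0])
qed (rule restricted_norm_bdd)

lemma restricted_norm_le_reduced_norm:
  assumes "subspace V"
  shows "restricted_norm V a \<le> reduced_norm a"
  unfolding reduced_norm_eq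
  by (intro restricted_norm_le[OF assms] norm_le_restricted_norm restricted_norm_nonneg subspace_UNIV UNIV_I)

text \<open>Invariance of \<open>V\<close> gives submultiplicativity, and \<open>faithful\<close> is
  exactly definiteness. The C*-identity comes from Cauchy-Schwarz, which gives \<open>sq_le\<close>;
  dividing the resulting estimate by the norm of \<open>a\<close> shows that the involution is
  isometric.\<close>

lemma cstar_norm_restricted_norm:
  assumes V: "subspace V"
    and inv: "\<And>a f. a \<in> grp_alg UNIV \<Longrightarrow> f \<in> V \<Longrightarrow> lrep a f \<in> V"
    and faithful: "\<And>a. a \<in> grp_alg UNIV \<Longrightarrow> (\<And>f. f \<in> V \<Longrightarrow> lrep a f = 0) \<Longrightarrow> a = (\<lambda>x. 0)"
  shows "cstar_norm (restricted_norm V)"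
proof -
  note ge = norm_le_restricted_norm[OF V]
  note nn = restricted_norm_nonneg[OF V]
  have zero: "restricted_norm V a = 0 \<longleftrightarrow> a = (\<lambda>x. 0)" if a: "a \<in> grp_alg UNIV" for a
  proof
    assume *: "restricted_norm V a = 0"
    show "a = (\<lambda>x. 0)" by (rule faithful[OF a]) (use ge[of _ a] * in simp)
  next
    assume "a = (\<lambda>x. 0)"
    then have "restricted_norm V a \<le> 0"
      by (intro restricted_norm_le[OF V]) (auto simp: lrep_apply)
    then show "restricted_norm V a = 0" using nn[of a] by simp
  qed
  have add: "restricted_norm V (\<lambda>x. a x + b x) \<le> restricted_norm V a + restricted_norm V b"
    if "a \<in> grp_alg UNIV" "b \<in> grp_alg UNIV" for a b
  proof (rule restricted_norm_le[OF V])
    fix f assume f: "f \<in> V"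
    show "norm (lrep (\<lambda>x. a x + b x) f) \<le> (restricted_norm V a + restricted_norm V b) * norm f"
      unfolding lrep_add[OF that] distrib_right by (intro norm_triangle_mono ge f)
  qed (intro add_nonneg_nonneg nn)
  have scale_le: "restricted_norm V (\<lambda>x. c * a x) \<le> cmod c * restricted_norm V a" for a c
    using ge[of _ a] nn[of a]
    by (intro restricted_norm_le[OF V]) (auto simp: lrep_scale norm_cscale mult.assoc intro!: mult_left_mono)
  have scale: "restricted_norm V (\<lambda>x. c * a x) = cmod c * restricted_norm V a" for a c
  proof (cases "c = 0")
    case True
    then show ?thesis using zero[of "\<lambda>x. 0"] by (simp add: grp_alg_UNIV)
  next
    \<comment> \<open>The reverse inequality is \<open>scale_le\<close> applied to the inverse
      scalar.\<close>
    case False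
    then have "restricted_norm V a \<le> cmod (inverse c) * restricted_norm V (\<lambda>x. c * a x)"
      using scale_le[of "inverse c" "\<lambda>x. c * a x"] by (simp add: mult.assoc[symmetric])
    then have "cmod c * restricted_norm V a
        \<le> cmod c * (cmod (inverse c) * restricted_norm V (\<lambda>x. c * a x))"
      by (rule mult_left_mono) simp
    also have "\<dots> = restricted_norm V (\<lambda>x. c * a x)"
      using False by (simp add: norm_inverse)
    finally have "cmod c * restricted_norm V a \<le> restricted_norm V (\<lambda>x. c * a x)" .
    then show ?thesis using scale_le[of c a] by simp
  qed
  have mult: "restricted_norm V (conv a b) \<le> restricted_norm V a * restricted_norm V b"
    if a: "a \<in> grp_alg UNIV" and b: "b \<in> grp_alg UNIV" for a b
  proof (rule restricted_norm_le[OF V])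
    fix f assume f: "f \<in> V"
    have "norm (lrep a (lrep b f)) \<le> restricted_norm V a * norm (lrep b f)"
      by (intro ge inv b f)
    also have "\<dots> \<le> restricted_norm V a * (restricted_norm V b * norm f)"
      by (intro mult_left_mono ge f nn)
    finally show "norm (lrep (conv a b) f) \<le> restricted_norm V a * restricted_norm V b * norm f"
      by (simp add: lrep_conv[OF a b] mult.assoc)
  qed (intro mult_nonneg_nonneg nn)
  have sq_le: "(restricted_norm V a)\<^sup>2 \<le> restricted_norm V (conv (inv_star a) a)"
    if a: "a \<in> grp_alg UNIV" for a
  proof -
    let ?c = "restricted_norm V (conv (inv_star a) a)"
    have "restricted_norm V a \<le> sqrt ?c"
    proof (rule restricted_norm_le[OF V])
      fix f assume f: "f \<in> V"
      have "(norm (lrep a f))\<^sup>2 = inner f (lrep (conv (inv_star a) a) f)"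
        by (simp add: power2_norm_eq_inner inner_lrep lrep_conv a grp_alg_inv_star)
      also have "\<dots> \<le> norm f * norm (lrep (conv (inv_star a) a) f)" by (rule norm_cauchy_schwarz)
      also have "\<dots> \<le> norm f * (?c * norm f)" by (intro mult_left_mono ge f) simp
      also have "\<dots> = (sqrt ?c * norm f)\<^sup>2"
        using nn by (simp add: power_mult_distrib power2_eq_square)
      finally show "norm (lrep a f) \<le> sqrt ?c * norm f"
        by (rule power2_le_imp_le) (simp add: nn)
    qed (simp add: nn)
    then show ?thesis using nn by (metis power_mono real_sqrt_pow2)
  qed
  have star_le: "restricted_norm V a \<le> restricted_norm V (inv_star a)" if a: "a \<in> grp_alg UNIV" for a
  proof (cases "restricted_norm V a = 0")
    case False
    have "restricted_norm V a * restricted_norm V a \<le> restricted_norm V (inv_star a) * restricted_norm V a"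
      using order_trans[OF sq_le[OF a] mult[OF grp_alg_inv_star[OF a] a]] by (simp add: power2_eq_square)
    then show ?thesis using nn[of a] False by simp
  qed (simp add: nn)
  have cstar: "restricted_norm V (conv (inv_star a) a) = (restricted_norm V a)\<^sup>2"
    if a: "a \<in> grp_alg UNIV" for a
  proof (rule antisym[OF _ sq_le[OF a]])
    have "restricted_norm V (inv_star a) \<le> restricted_norm V a"
      using star_le[OF grp_alg_inv_star[OF a]] by (simp add: inv_star_inv_star)
    then have "restricted_norm V (inv_star a) * restricted_norm V a \<le> restricted_norm V a * restricted_norm V a"
      by (intro mult_right_mono nn)
    then show "restricted_norm V (conv (inv_star a) a) \<le> (restricted_norm V a)\<^sup>2"
      using order_trans[OF mult[OF grp_alg_inv_star[OF a] a]] by (simp add: power2_eq_square)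
  qed
  show ?thesis unfolding cstar_norm_def using nn zero add scale mult cstar by blast
qed

section \<open>Restricting scalars to a subgroup of finite index\<close>

text \<open>Multiplication by the least common multiple \<open>L\<close> turns \<open>r\<close> into
  an integer that is greater than \<open>L n - 1\<close> and at most \<open>L n\<close>.\<close>

lemma in_fin_lattice_gap:
  assumes r: "in_fin_lattice H r" and fin: "finite (fin_orders H)"
    and gap: "real n - torsion_multiplier H < r" "r \<le> real n"
  shows "r = real n"
proof -
  define L where "L = Lcm (fin_orders H)"
  have \<theta>: "torsion_multiplier H = 1 / real L"
    using fin by (simp add: torsion_multiplier_def L_def)
  \<comment> \<open>Since \<open>1 / 0 = 0\<close>, the value \<open>L = 0\<close> would make
    \<open>gap\<close> say that \<open>r\<close> is both greater than \<open>n\<close> and at most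
    \<open>n\<close>.\<close>
  have L: "L > 0"
  proof (rule ccontr)
    assume "\<not> L > 0"
    then show False using gap \<theta> by simp
  qed
  obtain S c where S: "finite S" "\<And>K. K \<in> S \<Longrightarrow> subgrp K \<and> K \<subseteq> H \<and> finite K"
    "r = (\<Sum>K\<in>S. real_of_int (c K) / real (card K))"
    using r unfolding in_fin_lattice_def by blast
  have "\<exists>m::int. real L * (real_of_int (c K) / real (card K)) = real_of_int m" if K: "K \<in> S" for K
  proof -
    have "card K \<in> fin_orders H" unfolding fin_orders_def using S(2)[OF K] by blast
    then have "card K dvd L" unfolding L_def by (rule dvd_Lcm)
    then obtain q where q: "L = card K * q" by (rule dvdE)
    then have "card K \<noteq> 0" using L by auto
    then have "real L * (real_of_int (c K) / real (card K)) = real_of_int (int q * c K)"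
      unfolding q by simp
    then show ?thesis by blast
  qed
  then obtain m where m: "\<And>K. K \<in> S \<Longrightarrow> real L * (real_of_int (c K) / real (card K)) = real_of_int (m K)"
    by metis
  have int: "real L * r = real_of_int (\<Sum>K\<in>S. m K)"
    unfolding S(3) sum_distrib_left of_int_sum by (rule sum.cong[OF refl m])
  have "real L * (real n - 1 / real L) < real L * r"
    using gap(1) L \<theta> by (intro mult_strict_left_mono) auto
  then have "real_of_int (int L * int n - 1) < real_of_int (\<Sum>K\<in>S. m K)"
    unfolding int using L by (simp add: algebra_simps)
  moreover have "real_of_int (\<Sum>K\<in>S. m K) \<le> real_of_int (int L * int n)"
    unfolding int[symmetric] using gap(2) L by simp
  ultimately have "(\<Sum>K\<in>S. m K) = int L * int n" unfolding of_int_less_iff of_int_le_iff by linarith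
  then have "real L * r = real L * real n" using int by simp
  then show ?thesis using L by simp
qed

section \<open>Decomposition along a transversal of the left cosets\<close>

locale coset_reps =
  fixes H :: "'g::group_add set" and s :: "nat \<Rightarrow> 'g" and n :: nat
  assumes H: "subgrp H"
    and reps: "\<exists>!i. i < n \<and> - s i + x \<in> H"
begin

lemma zero_mem: "0 \<in> H" and add_mem: "x \<in> H \<Longrightarrow> y \<in> H \<Longrightarrow> x + y \<in> H"
  and uminus_mem: "x \<in> H \<Longrightarrow> - x \<in> H"
  using H by (auto simp: subgrp_def)

lemma rep_unique:
  assumes "i < n" "j < n" "- s i + (s j + h) \<in> H" "h \<in> H"
  shows "i = j"
proof -
  have "- s j + (s j + h) \<in> H" using assms(4) by (simp add: add.assoc[symmetric])
  then show ?thesis using reps[of "s j + h"] assms by blast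
qed

text \<open>Splitting along the left cosets \<open>s i + H\<close> identifies \<open>\<ell>\<^sup>2(G)\<close> with \<open>\<ell>\<^sup>2(H)\<^sup>n\<close>. The left action
  of \<open>\<complex>G\<close> commutes with right translations by \<open>H\<close>, so it becomes a matrix over \<open>\<complex>H\<close>.\<close>
definition pack :: "'g ell2 \<Rightarrow> nat \<Rightarrow> 'g \<Rightarrow> complex" where
  "pack f = (\<lambda>i h. if i < n \<and> h \<in> H then coord f (s i + h) else 0)"

lemma pack_eq_iff: "pack f = pack g \<longleftrightarrow> f = g"
proof
  assume eq: "pack f = pack g"
  show "f = g"
  proof (rule ell2_eqI)
    fix x
    obtain i where i: "i < n" "- s i + x \<in> H" using reps[of x] by blast
    have "s i + (- s i + x) = x" by (simp add: add.assoc[symmetric])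
    then show "coord f x = coord g x"
      using fun_cong[OF fun_cong[OF eq, of i], of "- s i + x"] i by (simp add: pack_def)
  qed
qed simp

lemma pack_zero: "pack 0 = (\<lambda>i x. 0)"
  by (intro ext) (simp add: pack_def coord_zero)

lemma pack_diff: "(\<lambda>i x. pack f i x - pack g i x) = pack (f - g)"
  by (intro ext) (simp add: pack_def coord_diff)

lemma coset_sum_infsum:
  fixes F :: "'g \<Rightarrow> 'b::banach"
  assumes F: "F summable_on UNIV"
  shows "(\<Sum>i<n. infsum (\<lambda>h. F (s i + h)) H) = infsum F UNIV"
proof -
  have inj: "inj_on (\<lambda>h. s i + h) H" for i by (auto intro: inj_onI)
  have "(\<Sum>i<n. infsum (\<lambda>h. F (s i + h)) H) = (\<Sum>i<n. infsum F ((\<lambda>h. s i + h) ` H))"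
    by (simp add: infsum_reindex[OF inj] o_def)
  also have "\<dots> = infsum F (\<Union>i<n. (\<lambda>h. s i + h) ` H)"
  proof (rule sum_infsum)
    show "F summable_on (\<lambda>h. s i + h) ` H" for i
      by (rule summable_on_subset_banach[OF F]) simp
    fix i j assume ij: "i \<in> {..<n}" "j \<in> {..<n}" "i \<noteq> j"
    show "(\<lambda>h. s i + h) ` H \<inter> (\<lambda>h. s j + h) ` H = {}"
    proof (rule ccontr)
      assume "(\<lambda>h. s i + h) ` H \<inter> (\<lambda>h. s j + h) ` H \<noteq> {}"
      then obtain h k where hk: "h \<in> H" "k \<in> H" "s i + h = s j + k" by auto
      have "- s i + (s j + k) \<in> H" unfolding hk(3)[symmetric] using hk(1) by (simp add: add.assoc[symmetric])
      then show False using rep_unique[of i j k] ij hk by simp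
    qed
  qed simp
  also have "(\<Union>i<n. (\<lambda>h. s i + h) ` H) = UNIV"
  proof (intro equalityI subset_UNIV subsetI)
    fix x
    obtain i where i: "i < n" "- s i + x \<in> H" using reps[of x] by blast
    have "s i + (- s i + x) = x" by (simp add: add.assoc[symmetric])
    then show "x \<in> (\<Union>i<n. (\<lambda>h. s i + h) ` H)" using i by (metis UN_I image_eqI lessThan_iff)
  qed
  finally show ?thesis .
qed

lemma l2n_inner_pack:
  "l2n_inner H n (pack f) (pack g) = l2_inner UNIV (coord f) (coord g)"
  unfolding l2n_inner_def l2_inner_def
    coset_sum_infsum[OF l2_product_summable[OF coord[of f] coord[of g]], symmetric]
  by (intro sum.cong infsum_cong refl) (simp add: pack_def)

lemma pack_in_l2n: "pack f \<in> l2n H n"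
proof -
  have "(\<lambda>h. (cmod (coord f (s i + h)))\<^sup>2) summable_on H" for i
  proof -
    have "(\<lambda>x. (cmod (coord f x))\<^sup>2) summable_on (\<lambda>h. s i + h) ` H"
      by (rule summable_on_subset_banach[OF _ subset_UNIV]) (use coord[of f] in \<open>simp add: l2_iff\<close>)
    then show ?thesis by (subst (asm) summable_on_reindex) (auto simp: inj_on_def o_def)
  qed
  then show ?thesis
    unfolding l2n_def l2_def pack_def by (auto cong: summable_on_cong)
qed

text \<open>The inverse of \<open>pack\<close> translates the component \<open>v i\<close> to the
  coset of \<open>s i\<close> and adds up the results, whose supports are disjoint.\<close>

lemma ex_pack:
  assumes v: "v \<in> l2n H n"
  obtains f where "pack f = v"
proof -
  have van: "v i h = 0" if "i < n" "h \<notin> H" for i h using v that by (auto simp: l2n_def l2_def)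
  have l2: "v i \<in> l2 UNIV" if "i < n" for i
  proof -
    have "(\<lambda>x. (cmod (v i x))\<^sup>2) summable_on H" using v that by (auto simp: l2n_def l2_def)
    also have "?this \<longleftrightarrow> (\<lambda>x. (cmod (v i x))\<^sup>2) summable_on UNIV"
      by (rule summable_on_cong_neutral) (use van[OF that] in auto)
    finally show ?thesis by (simp add: l2_iff)
  qed
  define f where "f = (\<Sum>i<n. transl (s i) (of_coord (v i)))"
  have cf: "coord f x = (\<Sum>i<n. v i (- s i + x))" for x
    unfolding f_def coord_sum coord_transl by (intro sum.cong refl) (simp add: of_coord_inverse l2)
  have "pack f = v"
  proof (intro ext)
    fix j h
    show "pack f j h = v j h"
    proof (cases "j < n \<and> h \<in> H")
      case True
      have "coord f (s j + h) = (\<Sum>i<n. if i = j then v j h else 0)"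
        unfolding cf
      proof (intro sum.cong refl)
        fix i assume i: "i \<in> {..<n}"
        show "v i (- s i + (s j + h)) = (if i = j then v j h else 0)"
        proof (cases "i = j")
          case True
          then show ?thesis by (simp add: add.assoc[symmetric])
        next
          case False
          then have "- s i + (s j + h) \<notin> H" using rep_unique[of i j h] True i by auto
          then show ?thesis using van i False by simp
        qed
      qed
      then show ?thesis using True by (simp add: pack_def)
    next
      case False
      then show ?thesis using v van by (cases "j < n") (auto simp: pack_def l2n_def)
    qed
  qed
  then show thesis by (rule that)
qed

text \<open>Through this identity the trace on matrices over \<open>H\<close> is computed at the
  vectors \<open>basis (s i)\<close> of the large group.\<close>

lemma unit_vec_pack:
  assumes "i < n"
  shows "unit_vec n i = pack (basis (s i))"
proof (intro ext)
  fix j h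
  have "s j + h = s i \<longleftrightarrow> j = i \<and> h = 0" if "j < n" "h \<in> H"
  proof
    assume eq: "s j + h = s i"
    have "- s i + (s j + h) \<in> H" unfolding eq by (simp add: zero_mem)
    then have "i = j" using rep_unique assms that by blast
    then have "s j + h = s j + 0" using eq by simp
    then have "h = 0" unfolding add_left_cancel .
    then show "j = i \<and> h = 0" using \<open>i = j\<close> by simp
  qed auto
  then show "unit_vec n i j h = pack (basis (s i)) j h"
    using assms by (auto simp: unit_vec_def pack_def coord_basis delta_e_def zero_mem)
qed

text \<open>Left translation by \<open>s i + k - s j\<close> carries the coset of \<open>s j\<close>
  to that of \<open>s i\<close>; the block \<open>(i, j)\<close> collects the coefficients of
  \<open>a\<close> at these elements.\<close>

definition blocks :: "('g \<Rightarrow> complex) \<Rightarrow> nat \<Rightarrow> nat \<Rightarrow> 'g \<Rightarrow> complex" where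
  "blocks a = (\<lambda>i j k. if k \<in> H then a (s i + k - s j) else 0)"

lemma blocks_grp_alg:
  assumes "a \<in> grp_alg UNIV"
  shows "blocks a i j \<in> grp_alg H"
proof -
  have "{k. blocks a i j k \<noteq> 0} \<subseteq> (\<lambda>g. - s i + g + s j) ` {x. a x \<noteq> 0}"
  proof
    fix k assume "k \<in> {k. blocks a i j k \<noteq> 0}"
    moreover have "k = - s i + (s i + k - s j) + s j"
      by (simp add: add.assoc diff_conv_add_uminus del: add_uminus_conv_diff)
    ultimately show "k \<in> (\<lambda>g. - s i + g + s j) ` {x. a x \<noteq> 0}"
      by (intro image_eqI[of _ _ "s i + k - s j"]) (auto simp: blocks_def split: if_splits)
  qed
  then have "finite {k. blocks a i j k \<noteq> 0}"
    using assms by (auto simp: grp_alg_UNIV intro: finite_subset)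
  then show ?thesis by (auto simp: grp_alg_def blocks_def)
qed

lemma mat_op_pack:
  assumes a: "a \<in> grp_alg UNIV"
  shows "mat_op H n (blocks a) (pack f) = pack (lrep a f)"
proof (intro ext)
  fix i h
  show "mat_op H n (blocks a) (pack f) i h = pack (lrep a f) i h"
  proof (cases "i < n \<and> h \<in> H")
    case True
    define S where "S = (\<lambda>j. {k. blocks a i j k \<noteq> 0})"
    have fin: "finite (S j)" for j
      using blocks_grp_alg[OF a] by (simp add: S_def grp_alg_def)
    have inH: "k \<in> H" if "k \<in> S j" for j k using that by (auto simp: S_def blocks_def split: if_splits)
    \<comment> \<open>For fixed \<open>i\<close>, each group element carries exactly one coset to
      that of \<open>s i\<close>. So the support of \<open>a\<close> is the disjoint union, over
      \<open>j\<close>, of the supports in row \<open>i\<close>.\<close>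
    have bij: "bij_betw (\<lambda>(j, k). s i + k - s j) (Sigma {..<n} S) {g. a g \<noteq> 0}"
    proof (rule bij_betwI')
      fix p q assume "p \<in> Sigma {..<n} S" "q \<in> Sigma {..<n} S"
      then obtain j k j' k' where p: "p = (j, k)" "j < n" "k \<in> S j" and q: "q = (j', k')" "j' < n" "k' \<in> S j'"
        by auto
      show "(case p of (j, k) \<Rightarrow> s i + k - s j) = (case q of (j, k) \<Rightarrow> s i + k - s j) \<longleftrightarrow> p = q"
      proof
        assume "(case p of (j, k) \<Rightarrow> s i + k - s j) = (case q of (j, k) \<Rightarrow> s i + k - s j)"
        then have eq: "k - s j = k' - s j'" using p q by (simp add: add_diff_eq[symmetric])
        have "- s j + (s j' + - k') = - k"
        proof -
          have "s j' + - k' = - (k' - s j')" by (simp add: minus_diff_eq)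
          also have "\<dots> = s j + - k" unfolding eq[symmetric] by simp
          finally have e: "s j' + - k' = s j + - k" .
          show ?thesis unfolding e by (rule minus_add_cancel)
        qed
        then have "j = j'"
          using rep_unique[of j j' "- k'"] p q inH uminus_mem by simp
        moreover have "k - s j' + s j' = k' - s j' + s j'" using eq calculation by simp
        then have "k = k'" unfolding diff_add_cancel .
        ultimately show "p = q" using p q by simp
      qed simp
    next
      fix p assume "p \<in> Sigma {..<n} S"
      then show "(case p of (j, k) \<Rightarrow> s i + k - s j) \<in> {g. a g \<noteq> 0}"
        by (auto simp: S_def blocks_def split: if_splits)
    next
      fix g assume g: "g \<in> {g. a g \<noteq> 0}"
      obtain j where j: "j < n" "- s j + (- g + s i) \<in> H" using reps[of "- g + s i"] by blast
      define k where "k = - (- s j + (- g + s i))"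
      have k: "k \<in> H" unfolding k_def by (rule uminus_mem[OF j(2)])
      have "g = s i + k - s j"
        unfolding k_def by (simp add: minus_add add.assoc)
      then show "\<exists>p\<in>Sigma {..<n} S. g = (case p of (j, k) \<Rightarrow> s i + k - s j)"
        using g j k by (intro bexI[of _ "(j, k)"]) (auto simp: S_def blocks_def)
    qed
    have "mat_op H n (blocks a) (pack f) i h
        = (\<Sum>j<n. \<Sum>k\<in>S j. blocks a i j k * pack f j (- k + h))"
      using True by (simp add: mat_op_def lreg_def S_def)
    also have "\<dots> = (\<Sum>j<n. \<Sum>k\<in>S j. a (s i + k - s j) * coord f (- (s i + k - s j) + (s i + h)))"
    proof (intro sum.cong refl)
      fix j k assume j: "j \<in> {..<n}" and k: "k \<in> S j"
      have "- k + h \<in> H" using inH[OF k] True by (simp add: add_mem uminus_mem)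
      moreover have "- (s i + k - s j) + (s i + h) = s j + (- k + h)"
        unfolding diff_conv_add_uminus minus_add minus_minus add.assoc minus_add_cancel ..
      ultimately show "blocks a i j k * pack f j (- k + h)
          = a (s i + k - s j) * coord f (- (s i + k - s j) + (s i + h))"
        using j inH[OF k] by (simp add: blocks_def pack_def)
    qed
    also have "\<dots> = (\<Sum>p\<in>Sigma {..<n} S. (\<lambda>g. a g * coord f (- g + (s i + h))) (case p of (j, k) \<Rightarrow> s i + k - s j))"
      by (subst sum.Sigma) (auto simp: fin case_prod_unfold)
    also have "\<dots> = (\<Sum>g\<in>{g. a g \<noteq> 0}. a g * coord f (- g + (s i + h)))"
      by (rule sum.reindex_bij_betw[OF bij])
    also have "\<dots> = pack (lrep a f) i h"
      using True by (simp add: pack_def coord_lrep)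
    finally show ?thesis .
  next
    case False
    then show ?thesis by (auto simp: mat_op_def pack_def lreg_def)
  qed
qed

lemma mat_kernel_pack:
  assumes a: "a \<in> grp_alg UNIV"
  shows "mat_kernel H n (blocks a) = pack ` {f. lrep a f = 0}"
proof (intro equalityI subsetI)
  fix v assume v: "v \<in> mat_kernel H n (blocks a)"
  then obtain f where f: "pack f = v" using ex_pack unfolding mat_kernel_def by blast
  have "pack (lrep a f) = pack 0"
    using v unfolding mat_kernel_def f[symmetric] by (simp add: mat_op_pack[OF a] pack_zero)
  then show "v \<in> pack ` {f. lrep a f = 0}" using f by (auto simp: pack_eq_iff)
next
  fix v assume "v \<in> pack ` {f. lrep a f = 0}"
  then show "v \<in> mat_kernel H n (blocks a)"
    by (auto simp: mat_kernel_def pack_in_l2n mat_op_pack[OF a] pack_zero)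
qed

text \<open>Because \<open>K\<close> is closed under complex scalars, real and complex orthogonality
  to \<open>K\<close> agree. Uniqueness has to be shown as well, since \<open>orth_proj\<close> is a
  definite description.\<close>

lemma orth_proj_pack:
  assumes K: "subspace K" and Kc: "\<And>c f. f \<in> K \<Longrightarrow> blinfun_apply (cscale c) f \<in> K"
    and u: "u \<in> K" "\<And>k. k \<in> K \<Longrightarrow> inner (w - u) k = 0"
  shows "orth_proj H n (pack ` K) (pack w) = pack u"
  unfolding orth_proj_def
proof (rule the_equality)
  have "l2n_inner H n (pack (w - u)) (pack k) = 0" if "k \<in> K" for k
    using u(2) that Kc[OF that] by (simp add: l2n_inner_pack l2_inner_coord inner_cscale complex_eq_iff)
  then show "pack u \<in> pack ` K \<and>
      (\<forall>k\<in>pack ` K. l2n_inner H n (\<lambda>i x. pack w i x - pack u i x) k = 0)"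
    using u(1) by (auto simp: pack_diff)
next
  fix v assume v: "v \<in> pack ` K \<and> (\<forall>k\<in>pack ` K. l2n_inner H n (\<lambda>i x. pack w i x - v i x) k = 0)"
  then obtain z where z: "z \<in> K" "v = pack z" by blast
  have "inner (w - z) k = 0" if "k \<in> K" for k
    using v that unfolding z(2) by (auto simp: pack_diff l2n_inner_pack l2_inner_coord complex_eq_iff)
  then have "inner ((w - z) - (w - u)) (u - z) = 0"
    using u subspace_diff[OF K u(1) z(1)] unfolding inner_diff_left[of "w - z"] by simp
  then show "v = pack u" using z by simp
qed

text \<open>The diagonal entry of the projection at a unit vector is 1 minus its squared distance to
  the kernel. In this form the dimension can be bounded through any subspace of the kernel.\<close>

lemma vN_dim_ker_blocks:
  assumes a: "a \<in> grp_alg UNIV"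
    and u: "\<And>i. i < n \<Longrightarrow> lrep a (u i) = 0"
      "\<And>i k. i < n \<Longrightarrow> lrep a k = 0 \<Longrightarrow> inner (basis (s i) - u i) k = 0"
  shows "vN_dim_ker H n (blocks a) = (\<Sum>i<n. 1 - (norm (basis (s i) - u i))\<^sup>2)"
proof -
  have K: "subspace {f. blinfun_apply (lrep a) f = 0}"
    by (auto simp: subspace_def blinfun.bilinear_simps)
  have "Re (l2n_inner H n (orth_proj H n (mat_kernel H n (blocks a)) (unit_vec n i)) (unit_vec n i))
      = 1 - (norm (basis (s i) - u i))\<^sup>2" if i: "i < n" for i
  proof -
    have "orth_proj H n (mat_kernel H n (blocks a)) (unit_vec n i) = pack (u i)"
      unfolding mat_kernel_pack[OF a] unit_vec_pack[OF i]
      by (rule orth_proj_pack[OF K]) (use u i in \<open>auto simp: lrep_cscale blinfun.bilinear_simps\<close>)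
    moreover have "inner (basis (s i) - u i) (u i) = 0" using u i by blast
    moreover have "inner (basis (s i)) (basis (s i)) = 1"
      using norm_basis[of "s i"] by (simp add: norm_eq_sqrt_inner)
    ultimately show ?thesis
      unfolding unit_vec_pack[OF i] power2_norm_eq_inner
      by (simp add: l2n_inner_pack l2_inner_coord inner_diff_left inner_diff_right inner_commute)
  qed
  then show ?thesis unfolding vN_dim_ker_def Re_sum by (intro sum.cong) auto
qed

text \<open>The dimension of the kernel lies in \<open>(1 / L) \<int>\<close>, where \<open>L\<close> is the least common multiple
  of the finite subgroup orders, and is within less than \<open>1 / L\<close> of \<open>n\<close>; so it equals \<open>n\<close>.\<close>
lemma lrep_faithful:
  assumes atiyah: "strong_atiyah H" and fin: "finite (fin_orders H)"
    and v: "\<And>i. i < n \<Longrightarrow> v i \<in> V"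
    and codim: "(\<Sum>i<n. (norm (basis (s i) - v i))\<^sup>2) < torsion_multiplier H"
    and a: "a \<in> grp_alg UNIV" and ker: "\<And>f. f \<in> V \<Longrightarrow> lrep a f = 0"
  shows "a = (\<lambda>x. 0)"
proof -
  define K where "K = {f. blinfun_apply (lrep a) f = 0}"
  have K: "subspace K" unfolding K_def by (auto simp: subspace_def blinfun.bilinear_simps)
  have "closed K" unfolding K_def
    by (intro closed_Collect_eq linear_continuous_on blinfun.bounded_linear_right continuous_on_const)
  then have "\<exists>u\<in>K. \<forall>k\<in>K. inner (basis (s i) - u) k = 0" for i
    by (rule closed_subspace_projection[OF K])
  then obtain u where u: "\<And>i. u i \<in> K" "\<And>i k. k \<in> K \<Longrightarrow> inner (basis (s i) - u i) k = 0"
    by metis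
  \<comment> \<open>By \<open>ker\<close>, \<open>v i\<close> lies in the kernel \<open>K\<close>,
    and \<open>u i\<close> is the point of \<open>K\<close> nearest to
    \<open>basis (s i)\<close>.\<close>
  have le: "(norm (basis (s i) - u i))\<^sup>2 \<le> (norm (basis (s i) - v i))\<^sup>2" if i: "i < n" for i
  proof -
    have "u i - v i \<in> K" using ker[OF v[OF i]] by (intro subspace_diff[OF K] u) (simp add: K_def)
    then have "orthogonal (basis (s i) - u i) (u i - v i)" unfolding orthogonal_def by (rule u(2))
    then have "(norm ((basis (s i) - u i) + (u i - v i)))\<^sup>2
        = (norm (basis (s i) - u i))\<^sup>2 + (norm (u i - v i))\<^sup>2" by (rule norm_add_Pythagorean)
    then show ?thesis by simp
  qed
  have dim: "vN_dim_ker H n (blocks a) = (\<Sum>i<n. 1 - (norm (basis (s i) - u i))\<^sup>2)"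
    by (rule vN_dim_ker_blocks[OF a]) (use u in \<open>auto simp: K_def\<close>)
  also have "\<dots> = real n - (\<Sum>i<n. (norm (basis (s i) - u i))\<^sup>2)"
    by (simp add: sum_subtractf)
  finally have dim': "vN_dim_ker H n (blocks a) = real n - (\<Sum>i<n. (norm (basis (s i) - u i))\<^sup>2)" .
  have n: "n \<ge> 1" using reps[of 0] by auto
  have "in_fin_lattice H (vN_dim_ker H n (blocks a))"
    using atiyah n blocks_grp_alg[OF a] unfolding strong_atiyah_def by blast
  moreover have "real n - torsion_multiplier H < vN_dim_ker H n (blocks a)"
    using codim sum_mono[of "{..<n}" "\<lambda>i. (norm (basis (s i) - u i))\<^sup>2" "\<lambda>i. (norm (basis (s i) - v i))\<^sup>2"] le
    unfolding dim' by auto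
  moreover have "vN_dim_ker H n (blocks a) \<le> real n" unfolding dim' by (simp add: sum_nonneg)
  ultimately have "vN_dim_ker H n (blocks a) = real n" by (rule in_fin_lattice_gap[OF _ fin])
  then have "(\<Sum>i<n. (norm (basis (s i) - u i))\<^sup>2) = 0" unfolding dim' by simp
  \<comment> \<open>One basis vector in the kernel suffices: \<open>lrep a (basis (s 0))\<close> has
    the values of \<open>a\<close> as its coordinates.\<close>
  then have "(norm (basis (s 0) - u 0))\<^sup>2 = 0"
    by (subst (asm) sum_nonneg_eq_0_iff) (use n in auto)
  then have "basis (s 0) \<in> K" using u(1)[of 0] by simp
  then have "coord (lrep a (basis (s 0))) (x + s 0) = 0" for x by (simp add: K_def coord_zero)
  then show ?thesis unfolding coord_lrep_basis[OF a] by auto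
qed

end

lemma ex_coset_reps:
  assumes H: "subgrp H" and fin: "finite (cosets H)"
  obtains s where "coset_reps H s (grp_index H)"
proof -
  obtain e where e: "bij_betw e {..<grp_index H} (cosets H)"
    using ex_bij_betw_nat_finite[OF fin] unfolding grp_index_def atLeast0LessThan by blast
  have "\<exists>y. e i = ((+) y) ` H" if "i < grp_index H" for i
    using bij_betwE[OF e] that unfolding cosets_def by blast
  then obtain s where s: "\<And>i. i < grp_index H \<Longrightarrow> e i = ((+) (s i)) ` H" by metis
  have sub: "((+) x) ` H \<subseteq> ((+) y) ` H" if yx: "- y + x \<in> H" for x y
  proof (rule image_subsetI)
    fix h assume "h \<in> H"
    then have "(- y + x) + h \<in> H" using yx H unfolding subgrp_def by blast
    moreover have "x + h = y + ((- y + x) + h)" by (simp add: add.assoc[symmetric])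
    ultimately show "x + h \<in> ((+) y) ` H" by blast
  qed
  have mem: "- y + x \<in> H \<longleftrightarrow> ((+) x) ` H = ((+) y) ` H" for x y
  proof
    assume yx: "- y + x \<in> H"
    have xy: "- x + y \<in> H"
      using yx H unfolding subgrp_def by (metis minus_add minus_minus)
    show "((+) x) ` H = ((+) y) ` H" by (intro equalityI sub yx xy)
  next
    assume "((+) x) ` H = ((+) y) ` H"
    moreover have "x \<in> ((+) x) ` H" using H unfolding subgrp_def by (auto intro: image_eqI[of _ _ 0])
    ultimately obtain h where "h \<in> H" "x = y + h" by auto
    then show "- y + x \<in> H" by (simp add: add.assoc[symmetric])
  qed
  have "\<exists>!i. i < grp_index H \<and> - s i + x \<in> H" for x
  proof -
    have "((+) x) ` H \<in> cosets H" unfolding cosets_def by blast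
    then have "\<exists>!i. i \<in> {..<grp_index H} \<and> e i = ((+) x) ` H"
      using e unfolding bij_betw_def inj_on_def by (metis imageE)
    then show ?thesis using s by (metis (no_types, lifting) lessThan_iff mem)
  qed
  then show thesis using that H by (auto simp: coset_reps_def)
qed

section \<open>Central projections\<close>

lemma l2_subset_iff: "f \<in> l2 H \<longleftrightarrow> f \<in> l2 UNIV \<and> (\<forall>x. x \<notin> H \<longrightarrow> f x = 0)"
proof (cases "\<forall>x. x \<notin> H \<longrightarrow> f x = 0")
  case True
  have "(\<lambda>x. (cmod (f x))\<^sup>2) summable_on H \<longleftrightarrow> (\<lambda>x. (cmod (f x))\<^sup>2) summable_on UNIV"
    by (rule summable_on_cong_neutral) (use True in auto)
  then show ?thesis using True by (simp add: l2_def)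
qed (auto simp: l2_def)

lemma l2_norm_UNIV:
  assumes "\<And>x. x \<notin> H \<Longrightarrow> f x = 0"
  shows "l2_norm H f = l2_norm UNIV f"
  unfolding l2_norm_def by (intro arg_cong[of _ _ sqrt] infsum_cong_neutral) (use assms in auto)

lemma l2_inner_UNIV:
  assumes "\<And>x. x \<notin> H \<Longrightarrow> g x = 0" "\<And>x. x \<in> H \<Longrightarrow> f x = f' x"
  shows "l2_inner H f g = l2_inner UNIV f' g"
  unfolding l2_inner_def by (intro infsum_cong_neutral) (use assms in auto)

lemma l2_inner_finite:
  assumes "finite S" "S \<subseteq> H" "\<And>x. x \<notin> S \<Longrightarrow> f x * cnj (g x) = 0"
  shows "l2_inner H f g = (\<Sum>x\<in>S. f x * cnj (g x))"
  unfolding l2_inner_def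
  by (rule infsumI, rule has_sum_finite_neutralI[of S]) (use assms in auto)

lemma single_l2: "h \<in> H \<Longrightarrow> single h \<in> l2 H"
  unfolding l2_subset_iff[of _ H] using l2_finite_support[of "single h"] by (auto simp: single_def)

lemma l2_inner_single: "h \<in> H \<Longrightarrow> l2_inner H f (single h) = f h"
  by (subst l2_inner_finite[of "{h}"]) (auto simp: single_def)

lemma l2_inner_single_left: "h \<in> H \<Longrightarrow> l2_inner H (single h) f = cnj (f h)"
  by (subst l2_inner_finite[of "{h}"]) (auto simp: single_def)

lemma id_commutant: "(\<lambda>f. f) \<in> commutant H M"
  unfolding commutant_def bdd_op_def by (auto intro!: exI[of _ 1])

text \<open>This makes the set whose infimum is \<open>central_granularity H\<close> nonempty, so
  that a projection of small trace can be extracted from a bound on the infimum.\<close>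

lemma id_central_projection:
  assumes "0 \<in> H"
  shows "(\<lambda>f. f) \<in> vN_center H \<and> is_projection H (\<lambda>f. f) \<and> nonzero_op H (\<lambda>f. f)"
proof -
  have "delta_e \<in> l2 H" using single_l2[OF assms] by (simp add: delta_e_single)
  moreover have "delta_e \<noteq> (\<lambda>x. 0)" by (metis delta_e_def zero_neq_one)
  moreover have "bdd_op H (\<lambda>f. f)" using id_commutant unfolding commutant_def by blast
  ultimately show ?thesis
    unfolding vN_center_def group_vN_def is_projection_def nonzero_op_def
    using id_commutant by blast
qed

lemma grp_alg_subset: "a \<in> grp_alg H \<Longrightarrow> a \<in> grp_alg UNIV"
  by (simp add: grp_alg_def)

lemma subgrp_mem_cancel:
  assumes "subgrp H" "h \<in> H"
  shows "- h + x \<in> H \<longleftrightarrow> x \<in> H" and "x + h \<in> H \<longleftrightarrow> x \<in> H"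
proof -
  have "h + (- h + x) \<in> H" if "- h + x \<in> H" using assms that unfolding subgrp_def by blast
  then show "- h + x \<in> H \<longleftrightarrow> x \<in> H" using assms unfolding subgrp_def by (auto simp: add.assoc[symmetric])
  have "(x + h) + - h \<in> H" if "x + h \<in> H" using assms that unfolding subgrp_def by blast
  then show "x + h \<in> H \<longleftrightarrow> x \<in> H" using assms unfolding subgrp_def by (auto simp: add.assoc)
qed

text \<open>A combination of translations by elements of \<open>H\<close> keeps functions supported
  in \<open>H\<close>, so the cut-off in \<open>lreg H\<close> changes nothing and operators on
  \<open>l2 H\<close> can be studied in \<open>ell2\<close>.\<close>

lemma lreg_eq_lrep:
  assumes H: "subgrp H" and a: "a \<in> grp_alg H" and f: "f \<in> l2 H"
  shows "lreg H a f = coord (lrep a (of_coord f))"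
proof
  fix x
  have f': "f \<in> l2 UNIV" "\<And>x. x \<notin> H \<Longrightarrow> f x = 0" using f unfolding l2_subset_iff[of _ H] by auto
  show "lreg H a f x = coord (lrep a (of_coord f)) x"
  proof (cases "x \<in> H")
    case True
    then show ?thesis by (simp add: coord_lrep of_coord_inverse[OF f'(1)] lreg_def)
  next
    case False
    have "a g * f (- g + x) = 0" if "a g \<noteq> 0" for g
    proof -
      have "g \<in> H" using a that unfolding grp_alg_def by blast
      then have "- g + x \<notin> H" using False subgrp_mem_cancel(1)[OF H] by blast
      then show ?thesis using f'(2) by simp
    qed
    then show ?thesis using False by (simp add: coord_lrep of_coord_inverse[OF f'(1)] lreg_def)
  qed
qed

lemma bdd_op_lreg:
  assumes H: "subgrp H" and a: "a \<in> grp_alg H"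
  shows "bdd_op H (lreg H a)"
  unfolding bdd_op_def
proof (intro conjI ballI allI)
  fix f assume f: "f \<in> l2 H"
  show "lreg H a f \<in> l2 H"
    unfolding l2_subset_iff[of _ H]
  proof
    show "lreg H a f \<in> l2 UNIV" unfolding lreg_eq_lrep[OF H a f] by (rule coord)
  qed (simp add: lreg_def)
next
  fix f g assume "f \<in> l2 H" "g \<in> l2 H"
  show "lreg H a (\<lambda>x. f x + g x) = (\<lambda>x. lreg H a f x + lreg H a g x)"
    by (auto simp: lreg_def sum.distrib distrib_left)
next
  fix f c assume "f \<in> l2 H"
  show "lreg H a (\<lambda>x. c * f x) = (\<lambda>x. c * lreg H a f x)"
    by (auto simp: lreg_def sum_distrib_left algebra_simps)
next
  have "l2_norm H (lreg H a f) \<le> norm (lrep a) * l2_norm H f" if f: "f \<in> l2 H" for f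
  proof -
    have "l2_norm H (lreg H a f) = norm (lrep a (of_coord f))"
      by (subst l2_norm_UNIV) (auto simp: norm_ell2_l2_norm lreg_eq_lrep[OF H a f, symmetric] lreg_def)
    also have "\<dots> \<le> norm (lrep a) * norm (of_coord f)" by (rule norm_blinfun)
    also have "norm (of_coord f) = l2_norm H f"
      using f unfolding norm_ell2_l2_norm l2_subset_iff[of _ H]
      by (simp add: of_coord_inverse l2_norm_UNIV)
    finally show ?thesis .
  qed
  then show "\<exists>C. \<forall>f\<in>l2 H. l2_norm H (lreg H a f) \<le> C * l2_norm H f" by blast
qed

lemma lreg_group_vN:
  assumes "subgrp H" "a \<in> grp_alg H"
  shows "lreg H a \<in> group_vN H"
  unfolding group_vN_def commutant_def using bdd_op_lreg[OF assms] assms(2) by auto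

definition rtransl :: "'g::group_add \<Rightarrow> ('g \<Rightarrow> complex) \<Rightarrow> 'g \<Rightarrow> complex" where
  "rtransl k f = (\<lambda>x. f (x + k))"

text \<open>Every element of the bicommutant \<open>group_vN H\<close> therefore commutes with right
  translations by \<open>H\<close>.\<close>

lemma rtransl_commutant:
  assumes H: "subgrp H" and k: "k \<in> H"
  shows "rtransl k \<in> commutant H (lreg H ` grp_alg H)"
proof -
  have bij: "bij_betw (\<lambda>x. x + k) H H"
    by (rule bij_betw_byWitness[of _ "\<lambda>x. x + - k"])
      (use k H subgrp_mem_cancel(2)[OF H] in \<open>auto simp: subgrp_def add.assoc simp del: add_uminus_conv_diff\<close>)
  have mem: "rtransl k f \<in> l2 H" if "f \<in> l2 H" for f
    using that subgrp_mem_cancel(2)[OF H k] summable_on_reindex_bij_betw[OF bij, of "\<lambda>x. (cmod (f x))\<^sup>2"]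
    by (auto simp: l2_def rtransl_def)
  have norm: "l2_norm H (rtransl k f) = l2_norm H f" for f
    using infsum_reindex_bij_betw[OF bij, of "\<lambda>x. (cmod (f x))\<^sup>2"]
    by (simp add: l2_norm_def rtransl_def)
  have "bdd_op H (rtransl k)"
    unfolding bdd_op_def using mem norm by (auto simp: rtransl_def intro!: exI[of _ 1])
  moreover have "rtransl k (lreg H a f) = lreg H a (rtransl k f)" for a f
    using subgrp_mem_cancel(2)[OF H k] by (auto simp: rtransl_def lreg_def add.assoc)
  ultimately show ?thesis unfolding commutant_def by auto
qed

lemma lreg_single: "lreg H (single h) f x = (if x \<in> H then f (- h + x) else 0)"
  by (simp add: lreg_def single_def)

lemma lreg_delta_e:
  assumes a: "a \<in> grp_alg H"
  shows "lreg H a delta_e = a"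
proof
  fix x
  have "(\<Sum>g\<in>{y. a y \<noteq> 0}. a g * delta_e (- g + x)) = (\<Sum>g\<in>{y. a y \<noteq> 0}. if g = x then a g else 0)"
    by (intro sum.cong refl) (metis delta_e_def left_minus mult.right_neutral mult_zero_right neg_eq_iff_add_eq_0 minus_minus)
  also have "\<dots> = a x" using a by (simp add: grp_alg_def sum.delta)
  finally show "lreg H a delta_e x = a x" using a by (auto simp: lreg_def grp_alg_def)
qed

text \<open>The vector is \<open>\<phi> = p \<delta>\<^sub>e\<close>. It is invariant under conjugation because \<open>p\<close> commutes both with
  left translations (being in the commutant of \<open>LH\<close>) and with right ones (being in \<open>LH\<close>).\<close>
lemma central_projection_vector:
  assumes H: "subgrp H" and p: "p \<in> vN_center H" and proj: "is_projection H p"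
    and nz: "nonzero_op H p"
  obtains \<phi> :: "'g::group_add ell2" where "\<phi> \<noteq> 0" "(norm \<phi>)\<^sup>2 = Re (vN_trace H p)"
    "\<And>x. x \<notin> H \<Longrightarrow> coord \<phi> x = 0"
    "\<And>x h. h \<in> H \<Longrightarrow> coord \<phi> (- h + x + h) = coord \<phi> x"
    "\<And>x. coord \<phi> (- x) = cnj (coord \<phi> x)"
    "\<And>z. z \<in> grp_alg H \<Longrightarrow> inner (lrep z \<phi>) \<phi> = Re (\<Sum>x\<in>{x. z x \<noteq> 0}. z x * cnj (coord \<phi> x))"
proof -
  have H0: "0 \<in> H" and Hm: "\<And>x. x \<in> H \<Longrightarrow> - x \<in> H" and Ha: "\<And>x y. x \<in> H \<Longrightarrow> y \<in> H \<Longrightarrow> x + y \<in> H"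
    using H by (auto simp: subgrp_def)
  have \<delta>: "delta_e \<in> l2 H" using single_l2[OF H0] by (simp add: delta_e_single)
  have p_mem: "p f \<in> l2 H" if "f \<in> l2 H" for f
    using proj that unfolding is_projection_def bdd_op_def by blast
  have p_idem: "p (p f) = p f" if "f \<in> l2 H" for f
    using proj that unfolding is_projection_def by blast
  have p_sa: "l2_inner H (p f) g = l2_inner H f (p g)" if "f \<in> l2 H" "g \<in> l2 H" for f g
    using proj that unfolding is_projection_def by blast
  have p_left: "p (lreg H a f) = lreg H a (p f)" if "a \<in> grp_alg H" "f \<in> l2 H" for a f
    using p lreg_group_vN[OF H that(1)] that(2) unfolding vN_center_def commutant_def by blast
  have p_right: "p (rtransl k f) = rtransl k (p f)" if "k \<in> H" "f \<in> l2 H" for k f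
    using p rtransl_commutant[OF H that(1)] that(2) unfolding vN_center_def group_vN_def commutant_def by blast
  define f where "f = p delta_e"
  have f: "f \<in> l2 H" unfolding f_def by (rule p_mem[OF \<delta>])
  then have fU: "f \<in> l2 UNIV" and f0: "\<And>x. x \<notin> H \<Longrightarrow> f x = 0" unfolding l2_subset_iff[of _ H] by auto
  have cf: "coord (of_coord f) = f" by (rule of_coord_inverse[OF fU])
  have p_single: "p (single h) = lreg H (single h) f" if "h \<in> H" for h
    using p_left[OF single_grp_alg[OF that] \<delta>] lreg_delta_e[OF single_grp_alg[OF that]] by (simp add: f_def)
  have class_fun: "f (- h + x + h) = f x" if h: "h \<in> H" for h x
  proof (cases "x \<in> H")
    case True
    \<comment> \<open>The point mass at \<open>h\<close> is both a left and a right translate of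
      \<open>delta_e\<close>; the two resulting formulas for its image under \<open>p\<close>
      express invariance under conjugation.\<close>
    have "rtransl (- h) delta_e = single h"
      by (auto simp: rtransl_def delta_e_def single_def)
    then have "lreg H (single h) f = rtransl (- h) f"
      using p_right[OF Hm[OF h] \<delta>] p_single[OF h] by (simp add: f_def)
    from fun_cong[OF this, of "x + h"] show ?thesis
      using Ha[OF True h] by (simp add: lreg_single rtransl_def add.assoc)
  next
    case False
    then have "- h + x + h \<notin> H" using subgrp_mem_cancel[OF H h] by blast
    then show ?thesis using False f0 by simp
  qed
  have star: "f (- x) = cnj (f x)" for x
  proof (cases "x \<in> H")
    case True
    have "f x = l2_inner H (p delta_e) (single x)" using l2_inner_single[OF True] by (simp add: f_def)
    also have "\<dots> = l2_inner H (single 0) (lreg H (single x) f)"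
      using p_sa[OF \<delta> single_l2[OF True]] p_single[OF True] by (simp add: delta_e_single)
    also have "\<dots> = cnj (f (- x))" using l2_inner_single_left[OF H0] H0 by (simp add: lreg_single)
    finally show ?thesis by simp
  next
    case False
    then have "- x \<notin> H" using Hm by fastforce
    then show ?thesis using False f0 by simp
  qed
  \<comment> \<open>If \<open>f\<close> were 0, \<open>p\<close> would kill every point mass, and by
    self-adjointness every coordinate of \<open>p g\<close> would vanish.\<close>
  have nonzero: "of_coord f \<noteq> 0"
  proof
    assume "of_coord f = 0"
    then have fz: "f = (\<lambda>x. 0)" using cf by (auto simp: coord_zero fun_eq_iff)
    have "p g x = 0" if g: "g \<in> l2 H" for g x
    proof (cases "x \<in> H")
      case True
      have "p g x = l2_inner H g (p (single x))"
        using l2_inner_single[OF True] p_sa[OF g single_l2[OF True]] by simp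
      also have "p (single x) = (\<lambda>x. 0)"
        unfolding p_single[OF True] by (auto simp: fz lreg_single)
      finally show ?thesis by (simp add: l2_inner_def)
    qed (use p_mem[OF g] in \<open>auto simp: l2_def\<close>)
    then show False using nz unfolding nonzero_op_def by blast
  qed
  have "l2_inner H f f = l2_inner H f delta_e"
    unfolding f_def using p_sa[OF p_mem[OF \<delta>] \<delta>] p_idem[OF \<delta>] by simp
  then have trace: "(norm (of_coord f))\<^sup>2 = Re (vN_trace H p)"
    unfolding power2_norm_eq_inner inner_ell2_def cf vN_trace_def f_def[symmetric]
    using l2_inner_UNIV[of H f f f] f0 by simp
  \<comment> \<open>Here \<open>lrep z\<close> applied to \<open>p delta_e\<close> is
    \<open>p z\<close>; self-adjointness moves \<open>p\<close> to the other side, where it fixes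
    \<open>f\<close>.\<close>
  have vec: "inner (lrep z (of_coord f)) (of_coord f) = Re (\<Sum>x\<in>{x. z x \<noteq> 0}. z x * cnj (f x))"
    if z: "z \<in> grp_alg H" for z
  proof -
    have zl2: "z \<in> l2 H" unfolding l2_subset_iff[of _ H]
      using z l2_finite_support[of z] by (auto simp: grp_alg_def)
    have "l2_inner UNIV (coord (lrep z (of_coord f))) f = l2_inner H (lreg H z f) f"
      by (rule l2_inner_UNIV[symmetric]) (simp_all add: f0 lreg_eq_lrep[OF H z f])
    also have "\<dots> = l2_inner H (p z) f"
      using p_left[OF z \<delta>] lreg_delta_e[OF z] by (simp add: f_def)
    also have "\<dots> = l2_inner H z f" using p_sa[OF zl2 f] p_idem[OF \<delta>] by (simp add: f_def)
    also have "\<dots> = (\<Sum>x\<in>{x. z x \<noteq> 0}. z x * cnj (f x))"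
      using z by (intro l2_inner_finite) (auto simp: grp_alg_def)
    finally show ?thesis by (simp add: inner_ell2_def cf)
  qed
  show thesis
    using that[of "of_coord f"] nonzero trace f0 class_fun star vec unfolding cf by blast
qed

text \<open>Cutting at a level set of the modulus, instead of at an arbitrary finite set, lets the
  truncation inherit the conjugation invariance and the symmetry of \<open>f\<close>. Level sets are
  finite because each of their points contributes at least \<open>\<eta>\<close> squared to the
  squared norm.\<close>

lemma ell2_truncation:
  assumes c: "c < (norm f)\<^sup>2"
  obtains \<eta> where "\<eta> > 0" "finite {x. \<eta> \<le> cmod (coord f x)}"
    "c < (\<Sum>x\<in>{x. \<eta> \<le> cmod (coord f x)}. (cmod (coord f x))\<^sup>2)"
proof -
  have "((\<lambda>x. (cmod (coord f x))\<^sup>2) has_sum (norm f)\<^sup>2) UNIV"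
    unfolding norm_ell2_sq using coord[of f] unfolding l2_iff by (rule has_sum_infsum)
  from has_sum_finite_approximation[OF this, of "((norm f)\<^sup>2 - c) / 2"] c
  obtain F where F: "finite F" "dist (\<Sum>x\<in>F. (cmod (coord f x))\<^sup>2) ((norm f)\<^sup>2) \<le> ((norm f)\<^sup>2 - c) / 2"
    by auto
  then have cF: "c < (\<Sum>x\<in>F. (cmod (coord f x))\<^sup>2)"
    using c unfolding dist_real_def abs_le_iff by (simp add: field_simps)
  define F' where "F' = {x\<in>F. coord f x \<noteq> 0}"
  \<comment> \<open>Zeros of \<open>f\<close> were removed so that the minimum is positive; the
    inserted 1 covers an empty \<open>F'\<close>.\<close>
  define \<eta> where "\<eta> = Min (insert 1 ((\<lambda>x. cmod (coord f x)) ` F'))"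
  have F': "finite F'" using F(1) by (simp add: F'_def)
  have \<eta>: "\<eta> > 0" unfolding \<eta>_def using F' by (subst Min_gr_iff) (auto simp: F'_def)
  have sub: "F' \<subseteq> {x. \<eta> \<le> cmod (coord f x)}"
    unfolding \<eta>_def using F' by (auto intro!: Min_le)
  have fin: "finite {x. \<eta> \<le> cmod (coord f x)}"
  proof (rule ccontr)
    assume inf: "infinite {x. \<eta> \<le> cmod (coord f x)}"
    obtain k :: nat where k: "(norm f)\<^sup>2 / \<eta>\<^sup>2 < real k" using reals_Archimedean2 by blast
    obtain G where G: "finite G" "card G = k" "G \<subseteq> {x. \<eta> \<le> cmod (coord f x)}"
      using infinite_arbitrarily_large[OF inf] by blast
    have "real k * \<eta>\<^sup>2 = (\<Sum>x\<in>G. \<eta>\<^sup>2)" using G by simp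
    also have "\<dots> \<le> (\<Sum>x\<in>G. (cmod (coord f x))\<^sup>2)"
      using G(3) \<eta> by (intro sum_mono power_mono) auto
    also have "\<dots> \<le> (norm f)\<^sup>2" by (rule ell2_sum_le_norm[OF G(1)])
    finally show False using k \<eta> by (simp add: field_simps)
  qed
  have "(\<Sum>x\<in>F. (cmod (coord f x))\<^sup>2) = (\<Sum>x\<in>F'. (cmod (coord f x))\<^sup>2)"
    by (rule sum.mono_neutral_right) (auto simp: F'_def F(1))
  also have "\<dots> \<le> (\<Sum>x\<in>{x. \<eta> \<le> cmod (coord f x)}. (cmod (coord f x))\<^sup>2)"
    by (rule sum_mono2[OF fin sub]) simp
  finally show thesis using that[OF \<eta> fin] cF by simp
qed

section \<open>Central elements of the group ring\<close>

context coset_reps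
begin

text \<open>If \<open>z\<close> is a class function on \<open>H\<close>, each summand depends only on the coset \<open>s i + H\<close>, so the
  translations of \<open>G\<close> permute the summands by conjugation.\<close>
definition conj_sum :: "('g \<Rightarrow> complex) \<Rightarrow> 'g ell2 \<Rightarrow>\<^sub>L 'g ell2" where
  "conj_sum z = (\<Sum>i<n. transl (s i) o\<^sub>L lrep z o\<^sub>L lrep z o\<^sub>L transl (- s i))"

lemma conj_sum_apply: "conj_sum z f = (\<Sum>i<n. transl (s i) (lrep z (lrep z (transl (- s i) f))))"
  by (simp add: conj_sum_def blinfun_sum_apply)

lemma ex_lrep_conj_sum:
  assumes z: "z \<in> grp_alg UNIV"
  shows "\<exists>t\<in>grp_alg UNIV. conj_sum z = lrep t"
  unfolding conj_sum_def
proof (rule ex_lrep_sum)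
  fix i
  have "transl (s i) o\<^sub>L lrep z o\<^sub>L lrep z o\<^sub>L transl (- s i)
      = lrep (conv (single (s i)) (conv z (conv z (single (- s i)))))"
    by (rule blinfun_eqI)
      (simp add: lrep_conv grp_alg_conv single_grp_alg z lrep_single)
  then show "\<exists>a\<in>grp_alg UNIV. transl (s i) o\<^sub>L lrep z o\<^sub>L lrep z o\<^sub>L transl (- s i) = lrep a"
    by (metis UNIV_I grp_alg_conv single_grp_alg z)
qed simp

lemma inner_conj_sum:
  assumes "inv_star z = z"
  shows "inner (conj_sum z f) g = (\<Sum>i<n. inner (lrep z (transl (- s i) f)) (lrep z (transl (- s i) g)))"
  by (simp add: conj_sum_apply inner_sum_left inner_transl inner_lrep assms)

lemma conj_sum_transl:
  assumes z: "\<And>x h. h \<in> H \<Longrightarrow> z (- h + x + h) = z x"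
  shows "conj_sum z (transl g f) = transl g (conj_sum z f)"
proof -
  define U where "U = (\<lambda>y. transl y (lrep z (lrep z (transl (- y) (transl g f)))))"
  have U_coset: "U (y + h) = U y" if h: "h \<in> H" for y h
  proof -
    note comm = lrep_transl_class[of z "- h", OF z[OF uminus_mem[OF h]]]
    show ?thesis unfolding U_def minus_add transl_add comm transl_cancel ..
  qed
  \<comment> \<open>\<open>\<pi>\<close> is the permutation of the left cosets induced by left
    translation by \<open>g\<close>.\<close>
  have "\<exists>j. j < n \<and> - s j + (g + s i) \<in> H" for i using reps by blast
  then obtain \<pi> where \<pi>: "\<And>i. \<pi> i < n" "\<And>i. - s (\<pi> i) + (g + s i) \<in> H" by metis
  have inj: "inj_on \<pi> {..<n}"
  proof (rule inj_onI)
    fix i j assume ij: "i \<in> {..<n}" "j \<in> {..<n}" "\<pi> i = \<pi> j"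
    have "- (- s (\<pi> i) + (g + s i)) + (- s (\<pi> i) + (g + s j)) \<in> H"
      using add_mem[OF uminus_mem[OF \<pi>(2)[of i]] \<pi>(2)[of j]] unfolding ij(3) .
    also have "- (- s (\<pi> i) + (g + s i)) + (- s (\<pi> i) + (g + s j)) = - s i + s j"
      unfolding minus_add minus_minus add.assoc add_minus_cancel minus_add_cancel ..
    finally show "i = j" using rep_unique[of i j 0] ij zero_mem by simp
  qed
  have bij: "bij_betw \<pi> {..<n} {..<n}"
    unfolding bij_betw_def using inj \<pi>(1) endo_inj_surj[OF finite_lessThan _ inj] by blast
  have "transl g (conj_sum z f) = (\<Sum>i<n. U (g + s i))"
    unfolding conj_sum_apply blinfun.sum_right U_def minus_add transl_add transl_cancel ..
  also have "\<dots> = (\<Sum>i<n. U (s (\<pi> i)))"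
  proof (intro sum.cong refl)
    fix i
    have "g + s i = s (\<pi> i) + (- s (\<pi> i) + (g + s i))" by (simp add: add.assoc[symmetric])
    then show "U (g + s i) = U (s (\<pi> i))" using U_coset[OF \<pi>(2)] by metis
  qed
  also have "\<dots> = (\<Sum>i<n. U (s i))"
    by (rule sum.reindex_bij_betw[OF bij, of "\<lambda>i. U (s i)"])
  finally show ?thesis by (simp add: conj_sum_apply U_def)
qed

end

theorem theorem8:
  fixes \<Lambda> :: "'g::{group_add, countable} set"
  assumes "normal_subgrp \<Lambda>"
    and "finite (cosets \<Lambda>)"
    and "strong_atiyah \<Lambda>"
    and "real (grp_index \<Lambda>) ^ 2 * central_granularity \<Lambda> < torsion_multiplier \<Lambda>"
  shows "\<not> cr_unique TYPE('g)"
proof -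
  define N where "N = real (grp_index \<Lambda>)"
  have H: "subgrp \<Lambda>" using assms(1) by (simp add: normal_subgrp_def)
  obtain s where reps: "coset_reps \<Lambda> s (grp_index \<Lambda>)" using ex_coset_reps[OF H assms(2)] .
  interpret coset_reps \<Lambda> s "grp_index \<Lambda>" by (rule reps)
  have N: "N > 0" using reps[of 0] by (auto simp: N_def)
  define \<theta> where "\<theta> = torsion_multiplier \<Lambda>"
  have "central_granularity \<Lambda> < \<theta> / N\<^sup>2"
    using assms(4) N by (simp add: \<theta>_def N_def field_simps)
  then obtain p where p: "p \<in> vN_center \<Lambda>" "is_projection \<Lambda> p" "nonzero_op \<Lambda> p"
    "Re (vN_trace \<Lambda> p) < \<theta> / N\<^sup>2"
    using cInf_lessD[of "{Re (vN_trace \<Lambda> p) | p. p \<in> vN_center \<Lambda> \<and> is_projection \<Lambda> p \<and> nonzero_op \<Lambda> p}"]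
      id_central_projection[OF zero_mem] unfolding central_granularity_def by blast
  obtain \<phi> where \<phi>: "\<phi> \<noteq> 0" "(norm \<phi>)\<^sup>2 = Re (vN_trace \<Lambda> p)"
    and \<phi>_supp: "\<And>x. x \<notin> \<Lambda> \<Longrightarrow> coord \<phi> x = 0"
    and \<phi>_class: "\<And>x h. h \<in> \<Lambda> \<Longrightarrow> coord \<phi> (- h + x + h) = coord \<phi> x"
    and \<phi>_star: "\<And>x. coord \<phi> (- x) = cnj (coord \<phi> x)"
    and \<phi>_vec: "\<And>z. z \<in> grp_alg \<Lambda> \<Longrightarrow>
      inner (lrep z \<phi>) \<phi> = Re (\<Sum>x\<in>{x. z x \<noteq> 0}. z x * cnj (coord \<phi> x))"
    by (rule central_projection_vector[OF H p(1-3)]) (rule that; assumption)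
  have \<phi>_pos: "(norm \<phi>)\<^sup>2 > 0" using \<phi>(1) by simp
  have small: "N\<^sup>2 * (norm \<phi>)\<^sup>2 < \<theta>" using p(4) N by (simp add: \<phi>(2) field_simps)
  then have \<theta>_pos: "\<theta> > 0" using N \<phi>_pos by (meson less_trans mult_pos_pos zero_less_power)
  \<comment> \<open>The multiplier is 0 when there are infinitely many orders, so its positivity
    forces finiteness.\<close>
  then have fin: "finite (fin_orders \<Lambda>)"
    unfolding \<theta>_def torsion_multiplier_def by (auto split: if_splits)
  \<comment> \<open>The lower bound on \<open>r\<close> makes the Markov estimate for the complement
    of \<open>V\<close> fall below \<open>\<theta>\<close>; \<open>r < 1\<close> leaves room for
    truncating \<open>\<phi>\<close>.\<close>
  obtain r where r: "N\<^sup>2 * (norm \<phi>)\<^sup>2 / \<theta> < r" "r < 1"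
    using dense[of "N\<^sup>2 * (norm \<phi>)\<^sup>2 / \<theta>" 1] small \<theta>_pos by auto
  have r_pos: "r > 0" by (rule le_less_trans[OF _ r(1)]) (use \<theta>_pos in simp)
  have r_small: "N\<^sup>2 * (norm \<phi>)\<^sup>2 < r * \<theta>" using r(1) \<theta>_pos by (simp add: field_simps)
  \<comment> \<open>The square root anticipates Cauchy-Schwarz: the truncation controls the inner
    product with \<open>\<phi>\<close>, and squaring the resulting norm bound turns
    \<open>sqrt r\<close> into \<open>r\<close>.\<close>
  have "sqrt r * (norm \<phi>)\<^sup>2 < (norm \<phi>)\<^sup>2" using r r_pos \<phi>_pos by simp
  then obtain \<eta> where \<eta>: "\<eta> > 0" "finite {x. \<eta> \<le> cmod (coord \<phi> x)}"
    "sqrt r * (norm \<phi>)\<^sup>2 < (\<Sum>x\<in>{x. \<eta> \<le> cmod (coord \<phi> x)}. (cmod (coord \<phi> x))\<^sup>2)"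
    by (rule ell2_truncation)
  define z where "z = (\<lambda>x. if \<eta> \<le> cmod (coord \<phi> x) then coord \<phi> x else 0)"
  have z_supp: "{x. z x \<noteq> 0} = {x. \<eta> \<le> cmod (coord \<phi> x)}"
    using \<eta>(1) by (auto simp: z_def)
  have z: "z \<in> grp_alg \<Lambda>"
    unfolding grp_alg_def mem_Collect_eq z_supp using \<eta>(1,2) \<phi>_supp by force
  have z': "z \<in> grp_alg UNIV" by (rule grp_alg_subset[OF z])
  have z_class: "z (- h + x + h) = z x" if "h \<in> \<Lambda>" for x h
    using \<phi>_class[OF that] by (simp add: z_def)
  have z_star: "inv_star z = z" by (auto simp: inv_star_def z_def \<phi>_star)
  define m where "m = (\<Sum>x\<in>{x. \<eta> \<le> cmod (coord \<phi> x)}. (cmod (coord \<phi> x))\<^sup>2)"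
  have "inner (lrep z \<phi>) \<phi> = Re (\<Sum>x\<in>{x. \<eta> \<le> cmod (coord \<phi> x)}. of_real ((cmod (coord \<phi> x))\<^sup>2))"
    unfolding \<phi>_vec[OF z] z_supp
    by (intro arg_cong[of _ _ Re] sum.cong) (simp_all only: z_def mem_Collect_eq if_True complex_norm_square)
  then have inner_m: "inner (lrep z \<phi>) \<phi> = m" unfolding m_def by simp
  have lower: "r * (norm \<phi>)\<^sup>2 < (norm (lrep z \<phi>))\<^sup>2"
  proof -
    have "sqrt r * (norm \<phi>)\<^sup>2 < norm (lrep z \<phi>) * norm \<phi>"
      using \<eta>(3) norm_cauchy_schwarz[of "lrep z \<phi>" \<phi>] unfolding inner_m m_def by linarith
    then have "sqrt r * norm \<phi> < norm (lrep z \<phi>)"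
      using \<phi>(1) by (simp add: power2_eq_square mult.assoc[symmetric])
    then have "(sqrt r * norm \<phi>)\<^sup>2 < (norm (lrep z \<phi>))\<^sup>2"
      using r_pos by (intro power_strict_mono) auto
    then show ?thesis using r_pos by (simp add: power_mult_distrib)
  qed
  define T where "T = conj_sum z"
  obtain t where t: "t \<in> grp_alg UNIV" "T = lrep t"
    using ex_lrep_conj_sum[OF z'] unfolding T_def by blast
  have T_sa: "inner (T f) g = inner f (T g)" for f g
    unfolding T_def inner_conj_sum[OF z_star] inner_commute[of f] by (simp add: inner_commute)
  have T_form: "inner (T f) f = (\<Sum>i<grp_index \<Lambda>. (norm (lrep z (transl (- s i) f)))\<^sup>2)" for f
    unfolding T_def inner_conj_sum[OF z_star] power2_norm_eq_inner ..
  have T_nonneg: "inner (T f) f \<ge> 0" for f unfolding T_form by (simp add: sum_nonneg)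
  \<comment> \<open>Each of the \<open>N\<close> conjugates contributes at most the squared norm of
    \<open>\<phi>\<close>. The second factor \<open>N\<close> appears when the \<open>N\<close>
    coset representatives are summed in \<open>codim\<close>.\<close>
  have T_basis: "inner (T (basis x)) (basis x) \<le> N * (norm \<phi>)\<^sup>2" for x
  proof -
    have "cmod (z y) \<le> cmod (coord \<phi> y)" for y by (simp add: z_def)
    then have "inner (T (basis x)) (basis x) \<le> (\<Sum>i<grp_index \<Lambda>. (norm \<phi>)\<^sup>2)"
      unfolding T_form transl_basis by (intro sum_mono power_mono norm_lrep_basis_le z') auto
    then show ?thesis by (simp add: N_def)
  qed
  have T_\<phi>: "r * (norm \<phi>)\<^sup>2 < inner (T \<phi>) \<phi>"
  proof -
    \<comment> \<open>The representative of the trivial coset lies in \<open>\<Lambda>\<close>, so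
      its translation commutes with \<open>lrep z\<close>; the other summands are nonnegative and
      are dropped.\<close>
    obtain i where i: "i < grp_index \<Lambda>" "- s i \<in> \<Lambda>" using reps[of 0] by auto
    have "inner (transl (- s i) (lrep z \<phi>)) (transl (- s i) (lrep z \<phi>)) = inner (lrep z \<phi>) (lrep z \<phi>)"
      by (rule inner_transl_transl)
    then have "(norm (lrep z \<phi>))\<^sup>2 = (norm (lrep z (transl (- s i) \<phi>)))\<^sup>2"
      unfolding lrep_transl_class[of z, OF z_class[OF i(2)]] power2_norm_eq_inner by simp
    also have "\<dots> \<le> inner (T \<phi>) \<phi>"
      unfolding T_form using i(1)
      by (intro member_le_sum[of i _ "\<lambda>i. (norm (lrep z (transl (- s i) \<phi>)))\<^sup>2"]) auto
    finally show ?thesis using lower by simp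
  qed
  have T_comm: "lrep a o\<^sub>L T = T o\<^sub>L lrep a" for a
  proof (rule blinfun_eqI)
    fix f
    have "T (cscale c g) = cscale c (T g)" for c g unfolding t(2) by (rule lrep_cscale)
    moreover have "T (transl g f) = transl g (T f)" for g
      unfolding T_def by (rule conj_sum_transl[OF z_class])
    ultimately show "(lrep a o\<^sub>L T) f = (T o\<^sub>L lrep a) f"
      by (simp add: lrep_apply blinfun.sum_right)
  qed
  obtain V where V: "subspace V" "closed V"
    and V_inv: "\<And>S f. S o\<^sub>L T = T o\<^sub>L S \<Longrightarrow> f \<in> V \<Longrightarrow> blinfun_apply S f \<in> V"
    and V_le: "\<And>f. f \<in> V \<Longrightarrow> inner (T f) f \<le> r * (norm f)\<^sup>2"
    and V_ge: "\<And>f. \<forall>k\<in>V. inner f k = 0 \<Longrightarrow> r * (norm f)\<^sup>2 \<le> inner (T f) f"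
    by (rule spectral_subspace[OF T_sa, of r]) (rule that; assumption)
  have TV: "T f \<in> V" if "f \<in> V" for f by (rule V_inv[OF refl that])
  have "\<exists>v\<in>V. \<forall>k\<in>V. inner (basis (s i) - v) k = 0" for i
    by (rule closed_subspace_projection[OF V])
  then obtain v where v: "\<And>i. v i \<in> V" "\<And>i k. k \<in> V \<Longrightarrow> inner (basis (s i) - v i) k = 0"
    by metis
  \<comment> \<open>Markov's inequality: on the orthogonal complement of \<open>V\<close> the form
    of \<open>T\<close> is at least \<open>r\<close>, and it is dominated by the form at the basis
    vector, because the invariance of \<open>V\<close> under \<open>T\<close> removes the cross
    terms.\<close>
  have codim: "(\<Sum>i<grp_index \<Lambda>. (norm (basis (s i) - v i))\<^sup>2) < torsion_multiplier \<Lambda>"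
  proof -
    have "r * (norm (basis (s i) - v i))\<^sup>2 \<le> N * (norm \<phi>)\<^sup>2" for i
    proof -
      define w where "w = basis (s i) - v i"
      have cross: "inner w (T (v i)) = 0" unfolding w_def by (rule v(2)[OF TV[OF v(1)]])
      have "inner (T (w + v i)) (w + v i) = inner (T w) w + inner (T (v i)) (v i)"
        using cross T_sa[of w "v i"]
        by (simp add: blinfun.bilinear_simps inner_add_left inner_add_right inner_commute)
      then have "inner (T w) w \<le> inner (T (basis (s i))) (basis (s i))"
        using T_nonneg[of "v i"] by (simp add: w_def)
      moreover have "r * (norm w)\<^sup>2 \<le> inner (T w) w" unfolding w_def by (intro V_ge ballI v(2))
      ultimately show ?thesis using T_basis[of "s i"] unfolding w_def by linarith
    qed
    then have "(\<Sum>i<grp_index \<Lambda>. r * (norm (basis (s i) - v i))\<^sup>2) \<le> (\<Sum>i<grp_index \<Lambda>. N * (norm \<phi>)\<^sup>2)"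
      by (intro sum_mono)
    also have "\<dots> = N\<^sup>2 * (norm \<phi>)\<^sup>2" by (simp add: N_def power2_eq_square)
    finally have "r * (\<Sum>i<grp_index \<Lambda>. (norm (basis (s i) - v i))\<^sup>2) < r * \<theta>"
      using r_small by (simp add: sum_distrib_left)
    then show ?thesis using r_pos by (simp add: \<theta>_def)
  qed
  have "cstar_norm (restricted_norm V)"
  proof (rule cstar_norm_restricted_norm[OF V(1)])
    show "lrep a f \<in> V" if "f \<in> V" for a f by (rule V_inv[OF T_comm that])
    show "a = (\<lambda>x. 0)" if "a \<in> grp_alg UNIV" "\<And>f. f \<in> V \<Longrightarrow> lrep a f = 0" for a
      by (rule lrep_faithful[OF assms(3) fin v(1) codim that])
  qed
  moreover have "restricted_norm V t \<le> r"
  proof (rule restricted_norm_le[OF V(1)])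
    fix f assume f: "f \<in> V"
    define a where "a = (norm (T f))\<^sup>2"
    \<comment> \<open>Turns the form bound on \<open>V\<close> into a norm bound: positivity of
      \<open>T\<close> at \<open>T f - r f\<close> is expanded, and \<open>V_le\<close> is used at
      both \<open>f\<close> and \<open>T f\<close>.\<close>
    have "0 \<le> inner (T (T f - r *\<^sub>R f)) (T f - r *\<^sub>R f)" by (rule T_nonneg)
    also have "\<dots> = inner (T (T f)) (T f) - 2 * r * a + r\<^sup>2 * inner (T f) f"
      unfolding a_def power2_norm_eq_inner using T_sa[of "T f" f]
      by (simp add: blinfun.bilinear_simps inner_diff_left inner_diff_right power2_eq_square algebra_simps)
    also have "\<dots> \<le> r * a - 2 * r * a + r\<^sup>2 * (r * (norm f)\<^sup>2)"
      unfolding a_def by (intro add_mono diff_right_mono mult_left_mono V_le TV f) simp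
    finally have "r * a \<le> r * (r * norm f)\<^sup>2" by (simp add: power2_eq_square algebra_simps)
    then have "(norm (T f))\<^sup>2 \<le> (r * norm f)\<^sup>2" using r_pos unfolding a_def by simp
    then show "norm (lrep t f) \<le> r * norm f"
      unfolding t(2)[symmetric] by (rule power2_le_imp_le) (use r_pos in simp)
  qed (use r_pos in simp)
  \<comment> \<open>Otherwise Cauchy-Schwarz would bound the form of \<open>T\<close> at
    \<open>\<phi>\<close> by \<open>r\<close> times the squared norm, against
    \<open>T_\<phi>\<close>. Hence the two norms differ at \<open>t\<close>.\<close>
  moreover have "r < reduced_norm t"
  proof (rule ccontr)
    assume "\<not> r < reduced_norm t"
    then have le: "restricted_norm UNIV t \<le> r" unfolding reduced_norm_eq by simp
    have "inner (T \<phi>) \<phi> \<le> norm (T \<phi>) * norm \<phi>" by (rule norm_cauchy_schwarz)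
    also have "\<dots> \<le> (r * norm \<phi>) * norm \<phi>"
      using norm_le_restricted_norm[OF subspace_UNIV UNIV_I, of t \<phi>] mult_right_mono[OF le norm_ge_zero[of \<phi>]]
      unfolding t(2) by (intro mult_right_mono) auto
    finally show False using T_\<phi> by (simp add: power2_eq_square mult.assoc)
  qed
  ultimately show ?thesis
    unfolding cr_unique_def using t(1) restricted_norm_le_reduced_norm[OF V(1)]
    by (metis less_irrefl order_le_less_trans)
qed

end
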